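(* For any smooth spacetime $M$ there are bijections $$\mathrm{pt}'(M^{\triangle})\cong\mathrm{IP}(M)\qquad\text{and}\qquad\mathrm{pt}'(M^{\triangledown})\cong\mathrm{IF}(M).$$
   Context: A smooth spacetime is a connected Lorentzian manifold $(M,g)$ of dimension $\geq2$ (signature $(-+\cdots+)$) with a time orientation. A tangent vector $v$ is timelike if $g(v,v)<0$; a timelike curve is a piecewise $C^1$ curve all of whose tangent vectors are timelike and future directed. $x\ll y$ means there is a timelike curve from $x$ to $y$. For $A\subseteq M$: $I^+(A)=\{y:\exists x\in A,\ x\ll y\}$ and $I^-(A)=\{y:\exists x\in A,\ y\ll x\}$; these are open sets. $M$ is regarded as an ordered locale with frame $\mathcal{O}M$ of open sets, whose localic future and past cones are $U\mapsto I^+(U)$ and $U\mapsto I^-(U)$ for $U$ open. The images $\operatorname{im}(I^+)=\{I^+(U):U\in\mathcal{O}M\}$ and $\operatorname{im}(I^-)=\{I^-(U):U\in\mathcal{O}M\}$ are subframes of $\mathcal{O}M$; $M^{\triangle}$ (locale of futures) is the locale with frame $\operatorname{im}(I^+)$ and $M^{\triangledown}$ (locale of pasts) the locale with frame $\operatorname{im}(I^-)$. For a locale $Y$ with frame $\mathcal{O}Y$, $\mathrm{pt}'(Y)$ is the set of prime elements of $\mathcal{O}Y$: elements $P$ different from the top such that $U\wedge V\leq P$ implies $U\leq P$ or $V\leq P$. $\mathrm{IP}(M)$, the indecomposable past sets: subsets $P\subseteq M$ with $P\neq\varnothing$, $P=I^-(P)$, such that $P=I^-(A)\cup I^-(B)$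 implies $P=I^-(A)$ or $P=I^-(B)$. $\mathrm{IF}(M)$, the indecomposable future sets: subsets $F\subseteq M$ with $F\neq\varnothing$, $F=I^+(F)$, such that $F=I^+(A)\cup I^+(B)$ implies $F=I^+(A)$ or $F=I^+(B)$. *)

theory Defs
  imports "HOL-Analysis.Analysis" "HOL-Algebra.Lattice"
begin

section \<open>Smooth manifolds and tangent vectors\<close>

text \<open>
  \<open>ck_on k f S\<close> is meant for open \<open>S\<close>: \<open>f\<close> is of class \<open>C\<^sup>k\<close> on \<open>S\<close>.
\<close>

fun ck_on :: "nat \<Rightarrow> ('e::euclidean_space \<Rightarrow> 'f::real_normed_vector) \<Rightarrow> 'e set \<Rightarrow> bool" where
  "ck_on 0 f S \<longleftrightarrow> continuous_on S f"
| "ck_on (Suc k) f S \<longleftrightarrow>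
     (\<forall>x\<in>S. f differentiable (at x)) \<and> (\<forall>v. ck_on k (\<lambda>x. frechet_derivative f (at x) v) S)"

definition smooth_on :: "('e::euclidean_space \<Rightarrow> 'f::real_normed_vector) \<Rightarrow> 'e set \<Rightarrow> bool" where
  "smooth_on f S \<longleftrightarrow> (\<forall>k. ck_on k f S)"

text \<open>
  A chart is a pair of its domain \<open>U\<close> and a coordinate map; the values of the map outside \<open>U\<close>
  are irrelevant. The model space \<open>'e\<close> has dimension \<open>DIM('e)\<close>.
\<close>

type_synonym ('a, 'e) chart = "'a set \<times> ('a \<Rightarrow> 'e)"

abbreviation chart_dom :: "('a, 'e) chart \<Rightarrow> 'a set" where "chart_dom \<equiv> fst"

abbreviation coords :: "('a, 'e) chart \<Rightarrow> 'a \<Rightarrow> 'e" where "coords \<equiv> snd"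

definition chart_inv :: "('a, 'e) chart \<Rightarrow> 'e \<Rightarrow> 'a" where
  "chart_inv c = inv_into (chart_dom c) (coords c)"

definition is_chart :: "'a topology \<Rightarrow> ('a, 'e::euclidean_space) chart \<Rightarrow> bool" where
  "is_chart X c \<longleftrightarrow>
     openin X (chart_dom c) \<and> open (coords c ` chart_dom c) \<and>
     homeomorphic_map (subtopology X (chart_dom c)) (top_of_set (coords c ` chart_dom c)) (coords c)"

definition smooth_manifold :: "'a topology \<Rightarrow> ('a, 'e::euclidean_space) chart set \<Rightarrow> bool" where
  "smooth_manifold X A \<longleftrightarrow>
     Hausdorff_space X \<and> second_countable X \<and>
     (\<forall>c\<in>A. is_chart X c) \<and> (\<Union>c\<in>A. chart_dom c) = topspace X \<and>
     (\<forall>c\<in>A. \<forall>c'\<in>A. smooth_on (coords c' \<circ> chart_inv c) (coords c ` (chart_dom c \<inter> chart_dom c')))"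

text \<open>
  A tangent vector at \<open>p\<close> is the family of its coordinate vectors in all charts around \<open>p\<close>,
  related to each other by the Jacobians of the transition maps. The value \<open>0\<close> at the other charts
  is a convention which makes this representation unique. The vector space operations on the tangent
  space are chartwise.
\<close>

type_synonym ('a, 'e) tangent = "('a, 'e) chart \<Rightarrow> 'e"

definition tangent_space ::
    "('a, 'e::euclidean_space) chart set \<Rightarrow> 'a \<Rightarrow> ('a, 'e) tangent set" where
  "tangent_space A p =
     {v. (\<forall>c. \<not> (c \<in> A \<and> p \<in> chart_dom c) \<longrightarrow> v c = 0) \<and>
         (\<forall>c\<in>A. \<forall>c'\<in>A. p \<in> chart_dom c \<inter> chart_dom c' \<longrightarrow>
            v c' = frechet_derivative (coords c' \<circ> chart_inv c) (at (coords c p)) (v c))}"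

definition tangent_add ::
    "('a, 'e::euclidean_space) tangent \<Rightarrow> ('a, 'e) tangent \<Rightarrow> ('a, 'e) tangent" where
  "tangent_add v w = (\<lambda>c. v c + w c)"

definition tangent_scale ::
    "real \<Rightarrow> ('a, 'e::euclidean_space) tangent \<Rightarrow> ('a, 'e) tangent" where
  "tangent_scale r v = (\<lambda>c. r *\<^sub>R v c)"

text \<open>The tangent vector at \<open>p\<close> whose coordinate vector in the chart \<open>c\<close> is \<open>u\<close>.\<close>

definition coord_vector ::
    "('a, 'e::euclidean_space) chart set \<Rightarrow> ('a, 'e) chart \<Rightarrow> 'a \<Rightarrow> 'e \<Rightarrow> ('a, 'e) tangent" where
  "coord_vector A c p u =
     (\<lambda>c'. if c' \<in> A \<and> p \<in> chart_dom c'
           then frechet_derivative (coords c' \<circ> chart_inv c) (at (coords c p)) u else 0)"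

section \<open>Spacetimes\<close>

record ('a, 'e) spacetime =
  points :: "'a topology"
  atlas :: "('a, 'e) chart set"
  metric :: "'a \<Rightarrow> ('a, 'e) tangent \<Rightarrow> ('a, 'e) tangent \<Rightarrow> real"
  orientation :: "'a \<Rightarrow> ('a, 'e) tangent"

abbreviation tangents ::
    "('a, 'e::euclidean_space) spacetime \<Rightarrow> 'a \<Rightarrow> ('a, 'e) tangent set" where
  "tangents M \<equiv> tangent_space (atlas M)"

text \<open>
  The signature \<open>(-+\<dots>+)\<close> is expressed by an orthonormal frame with exactly one negative vector;
  since it has \<open>DIM('e)\<close> elements, it is automatically a basis of the tangent space.
\<close>

definition lorentzian_metric :: "('a, 'e::euclidean_space) spacetime \<Rightarrow> bool" where
  "lorentzian_metric M \<longleftrightarrow>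
     (\<forall>p\<in>topspace (points M).
        (\<forall>v\<in>tangents M p. \<forall>w\<in>tangents M p. metric M p v w = metric M p w v) \<and>
        (\<forall>v\<in>tangents M p. \<forall>v'\<in>tangents M p. \<forall>w\<in>tangents M p.
           metric M p (tangent_add v v') w = metric M p v w + metric M p v' w) \<and>
        (\<forall>r. \<forall>v\<in>tangents M p. \<forall>w\<in>tangents M p.
           metric M p (tangent_scale r v) w = r * metric M p v w) \<and>
        (\<exists>E. \<exists>b\<^sub>0\<in>Basis. (\<forall>b\<in>Basis. E b \<in> tangents M p) \<and>
           (\<forall>b\<in>Basis. \<forall>b'\<in>(Basis :: 'e set).
              metric M p (E b) (E b') = (if b \<noteq> b' then 0 else if b = b\<^sub>0 then - 1 else 1)))) \<and>
     (\<forall>c\<in>atlas M. \<forall>u w.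
        smooth_on (\<lambda>x. let p = chart_inv c x in
                     metric M p (coord_vector (atlas M) c p u) (coord_vector (atlas M) c p w))
          (coords c ` chart_dom c))"

definition timelike :: "('a, 'e::euclidean_space) spacetime \<Rightarrow> 'a \<Rightarrow> ('a, 'e) tangent \<Rightarrow> bool" where
  "timelike M p v \<longleftrightarrow> v \<in> tangents M p \<and> metric M p v v < 0"

text \<open>
  A time orientation is represented by a continuous timelike vector field; it enters later notions
  only through the time cones it selects, see \<open>future_timelike\<close>.
\<close>

definition time_orientation :: "('a, 'e::euclidean_space) spacetime \<Rightarrow> bool" where
  "time_orientation M \<longleftrightarrow>
     (\<forall>p\<in>topspace (points M). timelike M p (orientation M p)) \<and>
     (\<forall>c\<in>atlas M. continuous_map (subtopology (points M) (chart_dom c)) euclidean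
        (\<lambda>p. orientation M p c))"

definition smooth_spacetime :: "('a, 'e::euclidean_space) spacetime \<Rightarrow> bool" where
  "smooth_spacetime M \<longleftrightarrow>
     smooth_manifold (points M) (atlas M) \<and> DIM('e) \<ge> 2 \<and> connected_space (points M) \<and>
     lorentzian_metric M \<and> time_orientation M"

definition future_timelike ::
    "('a, 'e::euclidean_space) spacetime \<Rightarrow> 'a \<Rightarrow> ('a, 'e) tangent \<Rightarrow> bool" where
  "future_timelike M p v \<longleftrightarrow> timelike M p v \<and> metric M p (orientation M p) v < 0"

section \<open>Timelike curves and chronology\<close>

text \<open>Velocities are one-sided at the end points of the interval \<open>I\<close> of definition.\<close>

definition velocity ::
    "('a, 'e::euclidean_space) chart set \<Rightarrow> real set \<Rightarrow> (real \<Rightarrow> 'a) \<Rightarrow> real \<Rightarrow> ('a, 'e) tangent" where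
  "velocity A I \<gamma> t =
     (\<lambda>c. if c \<in> A \<and> \<gamma> t \<in> chart_dom c
          then vector_derivative (coords c \<circ> \<gamma>) (at t within I) else 0)"

definition C1_curve ::
    "('a, 'e::euclidean_space) spacetime \<Rightarrow> real set \<Rightarrow> (real \<Rightarrow> 'a) \<Rightarrow> bool" where
  "C1_curve M I \<gamma> \<longleftrightarrow>
     continuous_map (top_of_set I) (points M) \<gamma> \<and>
     (\<forall>c\<in>atlas M.
        (\<forall>t\<in>I. \<gamma> t \<in> chart_dom c \<longrightarrow> (coords c \<circ> \<gamma>) differentiable (at t within I)) \<and>
        continuous_on {t\<in>I. \<gamma> t \<in> chart_dom c} (\<lambda>t. velocity (atlas M) I \<gamma> t c))"

text \<open>
  The curve is \<open>C\<^sup>1\<close> on each closed piece of a partition of the interval; at a break point both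
  one-sided tangent vectors have to be timelike and future directed.
\<close>

definition timelike_curve ::
    "('a, 'e::euclidean_space) spacetime \<Rightarrow> real \<Rightarrow> real \<Rightarrow> (real \<Rightarrow> 'a) \<Rightarrow> bool" where
  "timelike_curve M a b \<gamma> \<longleftrightarrow>
     a < b \<and> continuous_map (top_of_set {a..b}) (points M) \<gamma> \<and>
     (\<exists>(n::nat) \<tau>. \<tau> 0 = a \<and> \<tau> n = b \<and>
        (\<forall>i<n. \<tau> i < \<tau> (Suc i) \<and> C1_curve M {\<tau> i..\<tau> (Suc i)} \<gamma> \<and>
           (\<forall>t\<in>{\<tau> i..\<tau> (Suc i)}.
              future_timelike M (\<gamma> t) (velocity (atlas M) {\<tau> i..\<tau> (Suc i)} \<gamma> t))))"

definition chronological :: "('a, 'e::euclidean_space) spacetime \<Rightarrow> 'a \<Rightarrow> 'a \<Rightarrow> bool" where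
  "chronological M x y \<longleftrightarrow> (\<exists>\<gamma> a b. timelike_curve M a b \<gamma> \<and> \<gamma> a = x \<and> \<gamma> b = y)"

definition chron_future :: "('a, 'e::euclidean_space) spacetime \<Rightarrow> 'a set \<Rightarrow> 'a set" where
  "chron_future M A = {y. \<exists>x\<in>A. chronological M x y}"

definition chron_past :: "('a, 'e::euclidean_space) spacetime \<Rightarrow> 'a set \<Rightarrow> 'a set" where
  "chron_past M A = {y. \<exists>x\<in>A. chronological M y x}"

section \<open>Locales of futures and pasts, and their points\<close>

text \<open>
  A locale is represented by its frame, as an order in the sense of \<^theory>\<open>HOL-Algebra.Lattice\<close>;
  the top element and binary meets below are those of the frame itself.
\<close>

definition frame_of_sets :: "'a set set \<Rightarrow> 'a set gorder" where
  "frame_of_sets F = \<lparr>carrier = F, eq = (=), le = (\<subseteq>)\<rparr>"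

definition locale_of_futures :: "('a, 'e::euclidean_space) spacetime \<Rightarrow> 'a set gorder" where
  "locale_of_futures M = frame_of_sets (chron_future M ` {U. openin (points M) U})"

definition locale_of_pasts :: "('a, 'e::euclidean_space) spacetime \<Rightarrow> 'a set gorder" where
  "locale_of_pasts M = frame_of_sets (chron_past M ` {U. openin (points M) U})"

definition prime_elements :: "'b gorder \<Rightarrow> 'b set" where
  "prime_elements L =
     {P \<in> carrier L. P \<noteq> \<top>\<^bsub>L\<^esub> \<and>
        (\<forall>U\<in>carrier L. \<forall>V\<in>carrier L.
           U \<sqinter>\<^bsub>L\<^esub> V \<sqsubseteq>\<^bsub>L\<^esub> P \<longrightarrow> U \<sqsubseteq>\<^bsub>L\<^esub> P \<or> V \<sqsubseteq>\<^bsub>L\<^esub> P)}"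

section \<open>Indecomposable past and future sets\<close>

definition indecomposable_pasts :: "('a, 'e::euclidean_space) spacetime \<Rightarrow> 'a set set" where
  "indecomposable_pasts M =
     {P. P \<subseteq> topspace (points M) \<and> P \<noteq> {} \<and> P = chron_past M P \<and>
        (\<forall>A B. A \<subseteq> topspace (points M) \<and> B \<subseteq> topspace (points M) \<and>
           P = chron_past M A \<union> chron_past M B \<longrightarrow> P = chron_past M A \<or> P = chron_past M B)}"

definition indecomposable_futures :: "('a, 'e::euclidean_space) spacetime \<Rightarrow> 'a set set" where
  "indecomposable_futures M =
     {F. F \<subseteq> topspace (points M) \<and> F \<noteq> {} \<and> F = chron_future M F \<and>
        (\<forall>A B. A \<subseteq> topspace (points M) \<and> B \<subseteq> topspace (points M) \<and>
           F = chron_future M A \<union> chron_future M B \<longrightarrow>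
           F = chron_future M A \<or> F = chron_future M B)}"

end

theory Submission
  imports Defs
begin

text \<open>
  The map \<open>F \<mapsto> I\<^sup>-(M - F)\<close>, with inverse \<open>Q \<mapsto> I\<^sup>+(M - Q)\<close>, is an order-reversing bijection between
  the fixed points of \<open>I\<^sup>+\<close> and those of \<open>I\<^sup>-\<close>. It turns intersections into unions, hence primes
  into indecomposables. This needs that the chronology is transitive and interpolating, that its
  cones are open, and that every neighbourhood of a point meets its past and its future. The last
  two hold because, in a chart, being future timelike is an open condition on a point and a
  coordinate vector jointly, so that straight segments with almost the direction of a
  given timelike vector are timelike curves.
\<close>

section \<open>Chronology-like relations\<close>

text \<open>The complement of an open future set is closed under going to the past but closed as a
  set, so complementation alone does not land among the fixed points of the past cone. Taking the
  past cone of the complement replaces it by its interior, and this can be undone because a point of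
  a future set always has a predecessor inside the set. The frame meets agree with intersections
  only thanks to the topology: two predecessors of a point, one in each of two future sets, need not
  have a common successor before that point, whereas openness of the intersection supplies a
  predecessor in both. The relation is axiomatised in a form invariant under reversal, so that the
  bijection for pasts is the one for futures applied to the converse. On the geometric side,
  timelike curves are only piecewise C1. The chronology is therefore treated as the transitive
  closure of connection by a single C1 arc, which leaves estimates for one arc at a time and lets
  the openness proof alter only the outermost arc of a chain.\<close>

definition up_set :: "('a \<Rightarrow> 'a \<Rightarrow> bool) \<Rightarrow> 'a set \<Rightarrow> 'a set" where
  "up_set R A = {y. \<exists>x\<in>A. R x y}"

lemma up_set_Un: "up_set R (A \<union> B) = up_set R A \<union> up_set R B"
  unfolding up_set_def by blast

lemma up_set_mono: "A \<subseteq> B \<Longrightarrow> up_set R A \<subseteq> up_set R B"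
  unfolding up_set_def by blast

lemma up_set_fixedD: "up_set R F = F \<Longrightarrow> x \<in> F \<Longrightarrow> R x y \<Longrightarrow> y \<in> F"
  unfolding up_set_def by blast

lemma up_set_fixedE:
  assumes "up_set R F = F" "y \<in> F"
  obtains x where "x \<in> F" "R x y"
proof -
  have "y \<in> up_set R F"
    using assms by simp
  then show ?thesis
    using that unfolding up_set_def by blast
qed

text \<open>The assumptions come in pairs exchanged by reversing the relation
  (\<open>open_up\<close> with \<open>open_down\<close>, \<open>ex_below\<close> with
  \<open>ex_above\<close>), and the remaining ones are symmetric; hence \<open>dual\<close>.\<close>

locale chronology =
  fixes X :: "'a topology" and R :: "'a \<Rightarrow> 'a \<Rightarrow> bool"
  assumes dom: "R x y \<Longrightarrow> x \<in> topspace X \<and> y \<in> topspace X"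
    and trans: "R x y \<Longrightarrow> R y z \<Longrightarrow> R x z"
    and interpolate: "R x z \<Longrightarrow> \<exists>y. R x y \<and> R y z"
    and open_up: "openin X {y. R x y}"
    and open_down: "openin X {x. R x y}"
    and ex_below: "openin X U \<Longrightarrow> x \<in> U \<Longrightarrow> \<exists>y\<in>U. R y x"
    and ex_above: "openin X U \<Longrightarrow> x \<in> U \<Longrightarrow> \<exists>y\<in>U. R x y"
begin

lemma dual: "chronology X R\<inverse>\<inverse>"
proof
  show "x \<in> topspace X \<and> y \<in> topspace X" if "R\<inverse>\<inverse> x y" for x y
    using that dom by auto
  show "R\<inverse>\<inverse> x z" if "R\<inverse>\<inverse> x y" "R\<inverse>\<inverse> y z" for x y z
    using that trans by auto
  show "\<exists>y. R\<inverse>\<inverse> x y \<and> R\<inverse>\<inverse> y z" if "R\<inverse>\<inverse> x z" for x z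
    using that interpolate[of z x] by auto
qed (simp_all add: open_up open_down ex_below ex_above)

lemma openin_up_set: "openin X (up_set R A)"
proof -
  have "up_set R A = (\<Union>x\<in>A. {y. R x y})"
    by (auto simp: up_set_def)
  then show ?thesis
    using open_up by auto
qed

text \<open>Transitivity gives one inclusion and interpolation the other. Thus every cone is a fixed
  point.\<close>

lemma up_set_idem: "up_set R (up_set R A) = up_set R A"
proof (intro equalityI subsetI)
  fix y assume "y \<in> up_set R (up_set R A)"
  then show "y \<in> up_set R A"
    using trans unfolding up_set_def by blast
next
  fix y assume "y \<in> up_set R A"
  then obtain x where "x \<in> A" "R x y"
    unfolding up_set_def by blast
  moreover from this obtain z where "R x z" "R z y"
    using interpolate by blast
  ultimately show "y \<in> up_set R (up_set R A)"
    unfolding up_set_def by blast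
qed

text \<open>Fixed points are cones and hence open, so \<open>ex_below\<close> applied to the open
  set \<open>F \<inter> G\<close> finds a predecessor of a given point in both sets at once.\<close>

lemma up_set_Int:
  assumes "up_set R F = F" "up_set R G = G"
  shows "up_set R (F \<inter> G) = F \<inter> G"
proof
  show "up_set R (F \<inter> G) \<subseteq> F \<inter> G"
    using up_set_fixedD[OF assms(1)] up_set_fixedD[OF assms(2)] unfolding up_set_def by blast
  have "openin X (F \<inter> G)"
    using openin_up_set[of F] openin_up_set[of G] assms by (simp add: openin_Int)
  then show "F \<inter> G \<subseteq> up_set R (F \<inter> G)"
    using ex_below[of "F \<inter> G"] unfolding up_set_def by blast
qed

text \<open>Cones are fixed by idempotence; conversely a fixed point is open and is the cone of
  itself.\<close>

lemma up_set_image: "up_set R ` {U. openin X U} = {F. up_set R F = F}"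
proof (intro equalityI subsetI)
  fix F assume "F \<in> up_set R ` {U. openin X U}"
  then show "F \<in> {F. up_set R F = F}"
    using up_set_idem by auto
next
  fix F assume "F \<in> {F. up_set R F = F}"
  then have "up_set R F = F" by blast
  then show "F \<in> up_set R ` {U. openin X U}"
    using openin_up_set[of F] by (metis imageI mem_Collect_eq)
qed

lemma up_set_fixed_subset: "up_set R F = F \<Longrightarrow> F \<subseteq> topspace X"
  using openin_subset[OF openin_up_set[of F]] by simp

lemma up_set_topspace: "up_set R (topspace X) = topspace X"
  using ex_below[OF openin_topspace] dom unfolding up_set_def by auto

text \<open>The top and the meet of an order are chosen by \<open>SOME\<close> among greatest
  elements; antisymmetry of inclusion pins the choice down.\<close>

lemma greatest_unique_SOME:
  assumes "greatest (frame_of_sets \<F>) x S"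
  shows "(SOME y. greatest (frame_of_sets \<F>) y S) = x"
  using assms by (rule some_equality) (use assms in \<open>simp add: greatest_def frame_of_sets_def subset_antisym\<close>)

lemma top_frame: "\<top>\<^bsub>frame_of_sets {F. up_set R F = F}\<^esub> = topspace X"
proof -
  have "greatest (frame_of_sets {F. up_set R F = F}) (topspace X) {F. up_set R F = F}"
    using up_set_topspace up_set_fixed_subset
    by (simp add: greatest_def frame_of_sets_def Upper_def)
  then show ?thesis
    unfolding top_def by (subst greatest_unique_SOME) (simp_all add: frame_of_sets_def)
qed

lemma meet_frame:
  assumes "up_set R F = F" "up_set R G = G"
  shows "F \<sqinter>\<^bsub>frame_of_sets {F. up_set R F = F}\<^esub> G = F \<inter> G"
proof -
  let ?L = "frame_of_sets {F. up_set R F = F}"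
  have "Lower ?L {F, G} = {H. up_set R H = H \<and> H \<subseteq> F \<inter> G}"
    using assms unfolding Lower_def frame_of_sets_def by auto
  then have "greatest ?L (F \<inter> G) (Lower ?L {F, G})"
    using up_set_Int[OF assms] by (auto simp add: greatest_def frame_of_sets_def)
  then show ?thesis
    unfolding meet_def inf_def by (rule greatest_unique_SOME)
qed

text \<open>Translates primality from the abstract order to plain inclusions and intersections of
  fixed points, the form in which duality is applied.\<close>

lemma prime_elements_frame:
  "prime_elements (frame_of_sets (up_set R ` {U. openin X U})) =
     {P. up_set R P = P \<and> P \<noteq> topspace X \<and>
        (\<forall>U V. up_set R U = U \<and> up_set R V = V \<and> U \<inter> V \<subseteq> P \<longrightarrow> U \<subseteq> P \<or> V \<subseteq> P)}"
  unfolding prime_elements_def up_set_image top_frame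
  by (auto simp: frame_of_sets_def meet_frame[unfolded frame_of_sets_def])

section \<open>Duality between future sets and past sets\<close>

abbreviation to_down :: "'a set \<Rightarrow> 'a set" where
  "to_down F \<equiv> up_set R\<inverse>\<inverse> (topspace X - F)"

abbreviation to_up :: "'a set \<Rightarrow> 'a set" where
  "to_up Q \<equiv> up_set R (topspace X - Q)"

text \<open>A point \<open>y\<close> of \<open>F\<close> has a predecessor \<open>x\<close> in
  \<open>F\<close>. Everything after \<open>x\<close> lies in \<open>F\<close>, so \<open>x\<close>
  is outside \<open>to_down F\<close> and shows that \<open>y\<close> is in the left-hand side.
  Conversely, a predecessor of a point outside \<open>F\<close> belongs to \<open>to_down F\<close>,
  so a point reached from outside \<open>to_down F\<close> lies in \<open>F\<close>.\<close>

lemma to_up_to_down: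
  assumes "up_set R F = F"
  shows "to_up (to_down F) = F"
proof (rule equalityI)
  have "\<exists>x\<in>topspace X - to_down F. R x y" if "y \<in> F" for y
  proof -
    obtain x where "x \<in> F" "R x y"
      using up_set_fixedE[OF assms \<open>y \<in> F\<close>] by blast
    moreover have "z \<in> F" if "R x z" for z
      using up_set_fixedD[OF assms \<open>x \<in> F\<close> that] .
    ultimately show ?thesis
      using dom unfolding up_set_def by auto
  qed
  then show "F \<subseteq> to_up (to_down F)"
    unfolding up_set_def by auto
  show "to_up (to_down F) \<subseteq> F"
    using dom unfolding up_set_def by auto
qed

end

context chronology
begin

text \<open>The locale interpreted in itself with time reversed: each fact above now also holds with
  past and future exchanged, in particular the other half of the inverse law.\<close>

interpretation dual: chronology X "R\<inverse>\<inverse>"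
  by (rule dual)

lemma to_down_to_up: "up_set R\<inverse>\<inverse> Q = Q \<Longrightarrow> to_down (to_up Q) = Q"
  using dual.to_up_to_down by simp

lemma to_down_Int:
  "to_down (F \<inter> G) = to_down F \<union> to_down G"
  by (simp add: Diff_Int up_set_Un)

lemma to_down_subset_iff:
  assumes "up_set R F = F" "up_set R G = G"
  shows "to_down F \<subseteq> to_down G \<longleftrightarrow> G \<subseteq> F"
proof
  assume "to_down F \<subseteq> to_down G"
  then have "to_up (to_down G) \<subseteq> to_up (to_down F)"
    by (rule up_set_mono[OF Diff_mono[OF subset_refl]])
  then show "G \<subseteq> F"
    by (simp only: to_up_to_down[OF assms(1)] to_up_to_down[OF assms(2)])
qed (intro up_set_mono Diff_mono subset_refl)

text \<open>Kept in the literal shape of \<open>indecomposable_pasts\<close> and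
  \<open>indecomposable_futures\<close>, so that these become instances by mere unfolding.\<close>

definition indecomposable_down_sets :: "'a set set" where
  "indecomposable_down_sets =
     {P. P \<subseteq> topspace X \<and> P \<noteq> {} \<and> P = up_set R\<inverse>\<inverse> P \<and>
        (\<forall>A B. A \<subseteq> topspace X \<and> B \<subseteq> topspace X \<and>
           P = up_set R\<inverse>\<inverse> A \<union> up_set R\<inverse>\<inverse> B \<longrightarrow> P = up_set R\<inverse>\<inverse> A \<or> P = up_set R\<inverse>\<inverse> B)}"

text \<open>Join-irreducible elements of a distributive lattice are join-prime: if
  \<open>Q \<subseteq> A \<union> B\<close>, then \<open>Q\<close> is the union of
  \<open>Q \<inter> A\<close> and \<open>Q \<inter> B\<close>, which are again fixed points. In the
  other direction, the cones of arbitrary sets are fixed points by idempotence. The join-prime form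
  is the exact dual of primality.\<close>

lemma indecomposable_down_sets_iff:
  "Q \<in> indecomposable_down_sets \<longleftrightarrow> up_set R\<inverse>\<inverse> Q = Q \<and> Q \<noteq> {} \<and>
     (\<forall>A B. up_set R\<inverse>\<inverse> A = A \<and> up_set R\<inverse>\<inverse> B = B \<and> Q \<subseteq> A \<union> B \<longrightarrow> Q \<subseteq> A \<or> Q \<subseteq> B)"
  (is "_ \<longleftrightarrow> ?rhs")
proof
  assume Q: "Q \<in> indecomposable_down_sets"
  then have fixed: "up_set R\<inverse>\<inverse> Q = Q" and "Q \<noteq> {}"
    by (auto simp: indecomposable_down_sets_def)
  moreover have "Q \<subseteq> A \<or> Q \<subseteq> B"
    if "up_set R\<inverse>\<inverse> A = A" "up_set R\<inverse>\<inverse> B = B" "Q \<subseteq> A \<union> B" for A B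
  proof -
    have AB: "up_set R\<inverse>\<inverse> (Q \<inter> A) = Q \<inter> A" "up_set R\<inverse>\<inverse> (Q \<inter> B) = Q \<inter> B"
      using dual.up_set_Int fixed that by auto
    then have "Q = up_set R\<inverse>\<inverse> (Q \<inter> A) \<union> up_set R\<inverse>\<inverse> (Q \<inter> B)"
      using that(3) by auto
    moreover have "Q \<inter> A \<subseteq> topspace X" "Q \<inter> B \<subseteq> topspace X"
      using dual.up_set_fixed_subset[OF fixed] by auto
    ultimately have "Q = Q \<inter> A \<or> Q = Q \<inter> B"
      using Q[unfolded indecomposable_down_sets_def mem_Collect_eq] AB by metis
    then show ?thesis
      by blast
  qed
  ultimately show ?rhs
    by blast
next
  assume ?rhs
  moreover from this have "Q \<subseteq> topspace X"
    using dual.up_set_fixed_subset[of Q] by simp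
  moreover have "Q = up_set R\<inverse>\<inverse> A \<or> Q = up_set R\<inverse>\<inverse> B"
    if "Q = up_set R\<inverse>\<inverse> A \<union> up_set R\<inverse>\<inverse> B" for A B
  proof -
    have "Q \<subseteq> up_set R\<inverse>\<inverse> A \<or> Q \<subseteq> up_set R\<inverse>\<inverse> B"
      using \<open>?rhs\<close> dual.up_set_idem[of A] dual.up_set_idem[of B] equalityD1[OF that] by metis
    then show ?thesis
      using that by blast
  qed
  ultimately show "Q \<in> indecomposable_down_sets"
    by (simp add: indecomposable_down_sets_def)
qed

theorem prime_bij_indecomposable:
  "bij_betw to_down (prime_elements (frame_of_sets (up_set R ` {U. openin X U})))
     indecomposable_down_sets"
proof -
  \<comment> \<open>A prime being proper corresponds to its image being non-empty: if
    \<open>to_down F\<close> is empty, then \<open>F\<close>, recovered by \<open>to_up\<close>, is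
    the cone of the whole space.\<close>
  have to_down_empty: "to_down F \<noteq> {} \<longleftrightarrow> F \<noteq> topspace X" if "up_set R F = F" for F
  proof -
    have "to_down (topspace X) = {}"
      by (simp add: up_set_def)
    moreover have "F = topspace X" if "to_down F = {}"
      using to_up_to_down[OF \<open>up_set R F = F\<close>] that up_set_topspace by simp
    ultimately show ?thesis
      by blast
  qed
  have prime_iff: "to_down P \<in> indecomposable_down_sets \<longleftrightarrow>
      P \<in> prime_elements (frame_of_sets (up_set R ` {U. openin X U}))"
    if P: "up_set R P = P" for P
  proof -
    have *: "to_down P \<subseteq> to_down U \<union> to_down V \<longleftrightarrow> U \<inter> V \<subseteq> P"
      if "up_set R U = U" "up_set R V = V" for U V
      using to_down_subset_iff[OF P up_set_Int[OF that]] by (simp only: to_down_Int)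
    have "(\<forall>A B. up_set R\<inverse>\<inverse> A = A \<and> up_set R\<inverse>\<inverse> B = B \<and> to_down P \<subseteq> A \<union> B \<longrightarrow>
             to_down P \<subseteq> A \<or> to_down P \<subseteq> B) \<longleftrightarrow>
          (\<forall>U V. up_set R U = U \<and> up_set R V = V \<and> U \<inter> V \<subseteq> P \<longrightarrow> U \<subseteq> P \<or> V \<subseteq> P)"
      (is "?l \<longleftrightarrow> ?r")
    proof
      assume l: ?l
      show ?r
      proof (intro allI impI, elim conjE)
        fix U V assume UV: "up_set R U = U" "up_set R V = V" "U \<inter> V \<subseteq> P"
        then have "to_down P \<subseteq> to_down U \<or> to_down P \<subseteq> to_down V"
          by (intro l[rule_format] conjI dual.up_set_idem) (simp only: *)
        then show "U \<subseteq> P \<or> V \<subseteq> P"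
          by (simp only: to_down_subset_iff[OF P UV(1)] to_down_subset_iff[OF P UV(2)])
      qed
    next
      assume r: ?r
      show ?l
      proof (intro allI impI, elim conjE)
        fix A B assume AB: "up_set R\<inverse>\<inverse> A = A" "up_set R\<inverse>\<inverse> B = B" "to_down P \<subseteq> A \<union> B"
        \<comment> \<open>Every past fixed point \<open>A\<close> is of the form
          \<open>to_down U\<close> with \<open>U = to_up A\<close>, so quantifying over past fixed
          points is quantifying over future ones.\<close>
        then have "to_up A \<inter> to_up B \<subseteq> P"
          using *[OF up_set_idem up_set_idem, of "topspace X - A" "topspace X - B"]
          by (simp only: to_down_to_up)
        then have "to_up A \<subseteq> P \<or> to_up B \<subseteq> P"
          by (intro r[rule_format] conjI up_set_idem)
        then show "to_down P \<subseteq> A \<or> to_down P \<subseteq> B"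
          using to_down_subset_iff[OF P up_set_idem, of "topspace X - A"]
            to_down_subset_iff[OF P up_set_idem, of "topspace X - B"]
          by (simp only: to_down_to_up AB)
      qed
    qed
    then show ?thesis
      using to_down_empty[OF P] P dual.up_set_idem[of "topspace X - P"]
      by (simp only: indecomposable_down_sets_iff prime_elements_frame mem_Collect_eq simp_thms)
  qed
  show ?thesis
  proof (rule bij_betw_byWitness[where f' = to_up])
    show "\<forall>P\<in>prime_elements (frame_of_sets (up_set R ` {U. openin X U})). to_up (to_down P) = P"
      by (simp add: prime_elements_frame to_up_to_down)
    show "\<forall>Q\<in>indecomposable_down_sets. to_down (to_up Q) = Q"
      by (simp add: indecomposable_down_sets_iff to_down_to_up)
    show "to_down ` prime_elements (frame_of_sets (up_set R ` {U. openin X U}))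
        \<subseteq> indecomposable_down_sets"
      using prime_iff by (auto simp: prime_elements_frame)
    show "to_up ` indecomposable_down_sets
        \<subseteq> prime_elements (frame_of_sets (up_set R ` {U. openin X U}))"
    proof (intro subsetI, elim imageE)
      fix P Q assume "P = to_up Q" "Q \<in> indecomposable_down_sets"
      then show "P \<in> prime_elements (frame_of_sets (up_set R ` {U. openin X U}))"
        using prime_iff[OF up_set_idem, of "topspace X - Q"] to_down_to_up[of Q]
        by (simp add: indecomposable_down_sets_iff)
    qed
  qed
qed

end

section \<open>Timelike arcs\<close>

text \<open>Charts are pairs, and they should not be split when they are quantified.\<close>

declare split_paired_All [simp del] split_paired_Ex [simp del]

text \<open>A single C1 piece with its velocity field as an explicit argument. Restriction,
  reparametrisation and congruence then work on \<open>has_vector_derivative\<close> directly,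
  without the choice operator hidden in \<open>velocity\<close>.\<close>

definition timelike_arc ::
    "('a, 'e::euclidean_space) spacetime \<Rightarrow> real \<Rightarrow> real \<Rightarrow> (real \<Rightarrow> 'a) \<Rightarrow> (real \<Rightarrow> ('a, 'e) tangent) \<Rightarrow> bool" where
  "timelike_arc M a b \<gamma> V \<longleftrightarrow>
     a < b \<and> continuous_map (top_of_set {a..b}) (points M) \<gamma> \<and>
     (\<forall>c\<in>atlas M.
        (\<forall>t\<in>{a..b}. \<gamma> t \<in> chart_dom c \<longrightarrow>
           ((coords c \<circ> \<gamma>) has_vector_derivative V t c) (at t within {a..b})) \<and>
        continuous_on {t\<in>{a..b}. \<gamma> t \<in> chart_dom c} (\<lambda>t. V t c)) \<and>
     (\<forall>t\<in>{a..b}. future_timelike M (\<gamma> t) (V t))"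

lemma timelike_arcI:
  assumes "a < b" "continuous_map (top_of_set {a..b}) (points M) \<gamma>"
    and "\<And>c t. c \<in> atlas M \<Longrightarrow> t \<in> {a..b} \<Longrightarrow> \<gamma> t \<in> chart_dom c \<Longrightarrow>
      ((coords c \<circ> \<gamma>) has_vector_derivative V t c) (at t within {a..b})"
    and "\<And>c. c \<in> atlas M \<Longrightarrow> continuous_on {t\<in>{a..b}. \<gamma> t \<in> chart_dom c} (\<lambda>t. V t c)"
    and "\<And>t. t \<in> {a..b} \<Longrightarrow> future_timelike M (\<gamma> t) (V t)"
  shows "timelike_arc M a b \<gamma> V"
  using assms unfolding timelike_arc_def by simp

lemma timelike_arcD:
  assumes "timelike_arc M a b \<gamma> V"
  shows "a < b" "continuous_map (top_of_set {a..b}) (points M) \<gamma>"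
    and "c \<in> atlas M \<Longrightarrow> t \<in> {a..b} \<Longrightarrow> \<gamma> t \<in> chart_dom c \<Longrightarrow>
      ((coords c \<circ> \<gamma>) has_vector_derivative V t c) (at t within {a..b})"
    and "c \<in> atlas M \<Longrightarrow> continuous_on {t\<in>{a..b}. \<gamma> t \<in> chart_dom c} (\<lambda>t. V t c)"
    and "t \<in> {a..b} \<Longrightarrow> future_timelike M (\<gamma> t) (V t)"
  using assms unfolding timelike_arc_def by simp_all

lemma future_timelike_tangent: "future_timelike M p v \<Longrightarrow> v \<in> tangents M p"
  by (simp add: future_timelike_def timelike_def)

lemma tangent_eq_0: "v \<in> tangents M p \<Longrightarrow> \<not> (c \<in> atlas M \<and> p \<in> chart_dom c) \<Longrightarrow> v c = 0"
  unfolding tangent_space_def mem_Collect_eq by blast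

lemma timelike_arc_velocity:
  assumes "a < b" "C1_curve M {a..b} \<gamma>"
    and "\<And>t. t \<in> {a..b} \<Longrightarrow> future_timelike M (\<gamma> t) (velocity (atlas M) {a..b} \<gamma> t)"
  shows "timelike_arc M a b \<gamma> (velocity (atlas M) {a..b} \<gamma>)"
  using assms
  by (auto simp: timelike_arc_def C1_curve_def velocity_def vector_derivative_works[symmetric])

text \<open>Derivatives within a nondegenerate closed interval are unique, also at its ends, which
  settles the charts around \<open>\<gamma> t\<close>. In all other charts both sides are 0, by the
  definition of \<open>velocity\<close> and by the convention in
  \<open>tangent_space\<close>.\<close>

lemma velocity_timelike_arc:
  assumes "timelike_arc M a b \<gamma> V" "t \<in> {a..b}"
  shows "velocity (atlas M) {a..b} \<gamma> t = V t"
proof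
  fix c
  show "velocity (atlas M) {a..b} \<gamma> t c = V t c"
  proof (cases "c \<in> atlas M \<and> \<gamma> t \<in> chart_dom c")
    case True
    then have "((coords c \<circ> \<gamma>) has_vector_derivative V t c) (at t within {a..b})"
      using assms by (simp add: timelike_arc_def)
    then show ?thesis
      using True assms
      by (simp add: velocity_def timelike_arc_def vector_derivative_within_closed_interval)
  next
    case False
    moreover have "V t \<in> tangents M (\<gamma> t)"
      using timelike_arcD(5)[OF assms] by (rule future_timelike_tangent)
    ultimately have "V t c = 0"
      using tangent_eq_0[OF _ False] by simp
    then show ?thesis
      using False by (auto simp: velocity_def)
  qed
qed

lemma timelike_arc_C1:
  assumes "timelike_arc M a b \<gamma> V"
  shows "C1_curve M {a..b} \<gamma>"
    and "t \<in> {a..b} \<Longrightarrow> future_timelike M (\<gamma> t) (velocity (atlas M) {a..b} \<gamma> t)"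
proof -
  have "(coords c \<circ> \<gamma>) differentiable (at t within {a..b})"
    if "c \<in> atlas M" "t \<in> {a..b}" "\<gamma> t \<in> chart_dom c" for c t
    using assms that unfolding timelike_arc_def has_vector_derivative_def differentiable_def by blast
  moreover have "continuous_on {t\<in>{a..b}. \<gamma> t \<in> chart_dom c} (\<lambda>t. velocity (atlas M) {a..b} \<gamma> t c)"
    if "c \<in> atlas M" for c
  proof -
    have "continuous_on {t\<in>{a..b}. \<gamma> t \<in> chart_dom c} (\<lambda>t. V t c)"
      using assms that by (simp add: timelike_arc_def)
    then show ?thesis
      by (rule continuous_on_eq) (simp add: velocity_timelike_arc[OF assms])
  qed
  ultimately show "C1_curve M {a..b} \<gamma>"
    using assms by (auto simp: timelike_arc_def C1_curve_def)
  show "t \<in> {a..b} \<Longrightarrow> future_timelike M (\<gamma> t) (velocity (atlas M) {a..b} \<gamma> t)"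
    using assms by (simp add: velocity_timelike_arc[OF assms]) (simp add: timelike_arc_def)
qed

lemma timelike_arc_cong:
  assumes "timelike_arc M a b \<gamma> V" and eq: "\<And>t. t \<in> {a..b} \<Longrightarrow> \<gamma> t = \<delta> t"
  shows "timelike_arc M a b \<delta> V"
proof -
  have "((coords c \<circ> \<delta>) has_vector_derivative V t c) (at t within {a..b})"
    if "c \<in> atlas M" "t \<in> {a..b}" "\<delta> t \<in> chart_dom c" for c t
  proof (rule has_vector_derivative_transform)
    show "((coords c \<circ> \<gamma>) has_vector_derivative V t c) (at t within {a..b})"
      using assms that unfolding timelike_arc_def by simp
  qed (use that eq in auto)
  moreover have "continuous_map (top_of_set {a..b}) (points M) \<delta>"
    using assms continuous_map_eq[of "top_of_set {a..b}" "points M" \<gamma> \<delta>]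
    by (simp add: timelike_arc_def)
  moreover have "{t\<in>{a..b}. \<delta> t \<in> chart_dom c} = {t\<in>{a..b}. \<gamma> t \<in> chart_dom c}" for c :: "('a,'b) chart"
    using eq by auto
  ultimately show ?thesis
    using assms by (auto simp: timelike_arc_def)
qed

lemma timelike_arc_subinterval:
  assumes arc: "timelike_arc M a b \<gamma> V" and "a \<le> a'" "a' < b'" "b' \<le> b"
  shows "timelike_arc M a' b' \<gamma> V"
proof -
  have sub: "{a'..b'} \<subseteq> {a..b}"
    using assms by auto
  show ?thesis
  proof (rule timelike_arcI)
    show "((coords c \<circ> \<gamma>) has_vector_derivative V t c) (at t within {a'..b'})"
      if "c \<in> atlas M" "t \<in> {a'..b'}" "\<gamma> t \<in> chart_dom c" for c t
      using timelike_arcD(3)[OF arc] that sub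
      by (intro has_vector_derivative_within_subset[OF _ sub]) auto
    show "continuous_map (top_of_set {a'..b'}) (points M) \<gamma>"
      using timelike_arcD(2)[OF arc] sub by (rule continuous_map_from_subtopology_mono)
    show "continuous_on {t\<in>{a'..b'}. \<gamma> t \<in> chart_dom c} (\<lambda>t. V t c)" if "c \<in> atlas M" for c
      using timelike_arcD(4)[OF arc that] sub by (rule_tac continuous_on_subset) auto
    show "future_timelike M (\<gamma> t) (V t)" if "t \<in> {a'..b'}" for t
      using timelike_arcD(5)[OF arc, of t] that sub by auto
  qed fact
qed

text \<open>Needed for concatenation, where the second arc has to start at the parameter at which
  the first curve ends.\<close>

lemma timelike_arc_shift:
  assumes arc: "timelike_arc M a b \<gamma> V"
  shows "timelike_arc M (a + s) (b + s) (\<lambda>t. \<gamma> (t - s)) (\<lambda>t. V (t - s))"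
proof -
  have im: "(\<lambda>t. t - s) ` {a + s..b + s} = {a..b}"
    using image_add_atLeastAtMost[of "- s" "a + s" "b + s"] by simp
  show ?thesis
  proof (rule timelike_arcI)
    show "((coords c \<circ> (\<lambda>t. \<gamma> (t - s))) has_vector_derivative V (t - s) c) (at t within {a + s..b + s})"
      if "c \<in> atlas M" "t \<in> {a + s..b + s}" "\<gamma> (t - s) \<in> chart_dom c" for c t
    proof -
      have "((coords c \<circ> \<gamma>) has_vector_derivative V (t - s) c) (at (t - s) within (\<lambda>t. t - s) ` {a + s..b + s})"
        using timelike_arcD(3)[OF arc, of c "t - s"] that unfolding im by auto
      moreover have "((\<lambda>t. t - s) has_vector_derivative 1) (at t within {a + s..b + s})"
        by (auto intro!: derivative_eq_intros)
      ultimately show ?thesis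
        using vector_diff_chain_within[of "\<lambda>t. t - s" 1 t "{a + s..b + s}" "coords c \<circ> \<gamma>"]
        by (simp add: comp_def)
    qed
    have "continuous_map (top_of_set {a + s..b + s}) (top_of_set {a..b}) (\<lambda>t. t - s)"
      by (auto intro!: continuous_intros)
    from continuous_map_compose[OF this timelike_arcD(2)[OF arc]]
    show "continuous_map (top_of_set {a + s..b + s}) (points M) (\<lambda>t. \<gamma> (t - s))"
      by (simp add: comp_def)
    show "continuous_on {t\<in>{a + s..b + s}. \<gamma> (t - s) \<in> chart_dom c} (\<lambda>t. V (t - s) c)"
      if "c \<in> atlas M" for c
      using timelike_arcD(4)[OF arc that]
      by (rule continuous_on_compose2) (auto intro!: continuous_intros)
    show "future_timelike M (\<gamma> (t - s)) (V (t - s))" if "t \<in> {a + s..b + s}" for t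
      using timelike_arcD(5)[OF arc, of "t - s"] that by auto
  qed (use timelike_arcD(1)[OF arc] in simp)
qed

section \<open>The chronology as chains of C1 arcs\<close>

definition arc_related :: "('a, 'e::euclidean_space) spacetime \<Rightarrow> 'a \<Rightarrow> 'a \<Rightarrow> bool" where
  "arc_related M x y \<longleftrightarrow> (\<exists>a b \<gamma> V. timelike_arc M a b \<gamma> V \<and> \<gamma> a = x \<and> \<gamma> b = y)"

lemma arc_related_in_points:
  "arc_related M x y \<Longrightarrow> x \<in> topspace (points M) \<and> y \<in> topspace (points M)"
  unfolding arc_related_def timelike_arc_def
  by (auto simp: continuous_map_def Pi_iff)

lemma arc_related_interpolate:
  assumes "arc_related M x y"
  obtains z where "arc_related M x z" "arc_related M z y"
proof -
  obtain a b \<gamma> V where arc: "timelike_arc M a b \<gamma> V" and "\<gamma> a = x" "\<gamma> b = y"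
    using assms unfolding arc_related_def by blast
  moreover have "a < b"
    using arc by (simp add: timelike_arc_def)
  then have "timelike_arc M a ((a + b) / 2) \<gamma> V" "timelike_arc M ((a + b) / 2) b \<gamma> V"
    by (auto intro!: timelike_arc_subinterval[OF arc] simp: field_simps)
  ultimately show thesis
    using that unfolding arc_related_def by blast
qed

lemma chronological_imp_tranclp:
  assumes "chronological M x y"
  shows "(arc_related M)\<^sup>+\<^sup>+ x y"
proof -
  obtain \<gamma> a b where "timelike_curve M a b \<gamma>" and xy: "\<gamma> a = x" "\<gamma> b = y"
    using assms unfolding chronological_def by blast
  then obtain n and \<tau> :: "nat \<Rightarrow> real" where \<tau>: "\<tau> 0 = a" "\<tau> n = b" "a < b" and
    pieces: "\<And>i. i < n \<Longrightarrow> \<tau> i < \<tau> (Suc i) \<and> C1_curve M {\<tau> i..\<tau> (Suc i)} \<gamma> \<and>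
      (\<forall>t\<in>{\<tau> i..\<tau> (Suc i)}. future_timelike M (\<gamma> t) (velocity (atlas M) {\<tau> i..\<tau> (Suc i)} \<gamma> t))"
    unfolding timelike_curve_def by blast
  have step: "arc_related M (\<gamma> (\<tau> i)) (\<gamma> (\<tau> (Suc i)))" if "i < n" for i
    using timelike_arc_velocity pieces[OF that] unfolding arc_related_def by blast
  have "i \<le> n \<Longrightarrow> i \<noteq> 0 \<Longrightarrow> (arc_related M)\<^sup>+\<^sup>+ (\<gamma> (\<tau> 0)) (\<gamma> (\<tau> i))" for i
  proof (induction i)
    case (Suc i)
    then show ?case
      using step[of i] by (cases "i = 0") (auto intro: tranclp.trancl_into_trancl)
  qed simp
  \<comment> \<open>Since \<open>a < b\<close>, the partition has at least one piece; this yields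
    the transitive closure rather than the reflexive one.\<close>
  moreover have "n \<noteq> 0"
    using \<tau> by (metis less_irrefl)
  ultimately show ?thesis
    using \<tau> xy by auto
qed

lemma arc_related_imp_chronological:
  assumes "arc_related M x y"
  shows "chronological M x y"
proof -
  obtain a b \<gamma> V where arc: "timelike_arc M a b \<gamma> V" and xy: "\<gamma> a = x" "\<gamma> b = y"
    using assms unfolding arc_related_def by blast
  have "timelike_curve M a b \<gamma>"
    proof -
    define \<tau> :: "nat \<Rightarrow> real" where "\<tau> i = (if i = 0 then a else b)" for i
    have "\<tau> 0 = a \<and> \<tau> 1 = b \<and> (\<forall>i<1. \<tau> i < \<tau> (Suc i) \<and> C1_curve M {\<tau> i..\<tau> (Suc i)} \<gamma> \<and>
        (\<forall>t\<in>{\<tau> i..\<tau> (Suc i)}. future_timelike M (\<gamma> t) (velocity (atlas M) {\<tau> i..\<tau> (Suc i)} \<gamma> t)))"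
      using timelike_arcD(1)[OF arc] timelike_arc_C1[OF arc] by (simp add: \<tau>_def)
    then show ?thesis
      using timelike_arcD(1,2)[OF arc] unfolding timelike_curve_def by blast
  qed
  then show ?thesis
    using xy unfolding chronological_def by blast
qed

text \<open>Appending one arc on the right is the induction step for the transitive closure, so two
  general piecewise curves never have to be joined.\<close>

lemma chronological_append_arc:
  assumes "chronological M x y" "arc_related M y z"
  shows "chronological M x z"
proof -
  obtain \<gamma> a b where curve: "timelike_curve M a b \<gamma>" and xy: "\<gamma> a = x" "\<gamma> b = y"
    using assms unfolding chronological_def by blast
  then obtain n and \<tau> :: "nat \<Rightarrow> real" where \<tau>: "\<tau> 0 = a" "\<tau> n = b" and
    pieces: "\<And>i. i < n \<Longrightarrow> \<tau> i < \<tau> (Suc i) \<and> C1_curve M {\<tau> i..\<tau> (Suc i)} \<gamma> \<and>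
      (\<forall>t\<in>{\<tau> i..\<tau> (Suc i)}. future_timelike M (\<gamma> t) (velocity (atlas M) {\<tau> i..\<tau> (Suc i)} \<gamma> t))"
    unfolding timelike_curve_def by blast
  have "a < b"
    using curve by (simp add: timelike_curve_def)
  obtain a' b' \<sigma>' V' where arc': "timelike_arc M a' b' \<sigma>' V'" and yz': "\<sigma>' a' = y" "\<sigma>' b' = z"
    using assms unfolding arc_related_def by blast
  define d where "d = b + (b' - a')"
  obtain \<sigma> V where arc: "timelike_arc M b d \<sigma> V" and yz: "\<sigma> b = y" "\<sigma> d = z"
  proof
    show "timelike_arc M b d (\<lambda>t. \<sigma>' (t - (b - a'))) (\<lambda>t. V' (t - (b - a')))"
      using timelike_arc_shift[OF arc', of "b - a'"] by (simp add: d_def algebra_simps)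
  qed (simp_all add: yz' d_def)
  have "b < d"
    using arc by (simp add: timelike_arc_def)
  define \<delta> where "\<delta> = (\<lambda>t. if t \<le> b then \<gamma> t else \<sigma> t)"
  \<comment> \<open>The old partition ends at index \<open>n\<close> with
    \<open>\<tau> n = b\<close>; the appended arc becomes the piece with index \<open>n\<close>,
    ending at the new point \<open>d\<close>.\<close>
  define \<tau>' where "\<tau>' = \<tau>(Suc n := d)"
  \<comment> \<open>Downward induction from \<open>n\<close>. It places all old pieces in the region
    \<open>t \<le> b\<close>, where \<open>\<delta>\<close> is \<open>\<gamma>\<close>.\<close>
  have mono: "i \<le> n \<Longrightarrow> \<tau> i \<le> b" for i
  proof (induction rule: inc_induct)
    case (step i)
    then show ?case
      using pieces[of i] by linarith
  qed (simp add: \<tau>)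
  \<comment> \<open>At \<open>t = b\<close> the definition of \<open>\<delta>\<close> selects
    \<open>\<gamma>\<close>, but both curves pass through \<open>y\<close> there.\<close>
  have \<delta>_\<sigma>: "\<sigma> t = \<delta> t" if "t \<in> {b..d}" for t
    using that xy yz by (auto simp: \<delta>_def)
  have "timelike_curve M a d \<delta>"
    unfolding timelike_curve_def
  proof (intro conjI exI allI impI)
    show "a < d" "\<tau>' 0 = a" "\<tau>' (Suc n) = d"
      using \<open>a < b\<close> \<open>b < d\<close> \<tau> by (auto simp: \<tau>'_def)
    show "continuous_map (top_of_set {a..d}) (points M) \<delta>"
      unfolding \<delta>_def
    proof (rule continuous_map_cases_le)
      have *: "subtopology (top_of_set {a..d}) {x \<in> topspace (top_of_set {a..d}). x \<le> b} = top_of_set {a..b}"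
        "subtopology (top_of_set {a..d}) {x \<in> topspace (top_of_set {a..d}). b \<le> x} = top_of_set {b..d}"
        using \<open>a < b\<close> \<open>b < d\<close>
        by (auto simp: subtopology_subtopology intro!: arg_cong[of _ _ "subtopology euclidean"])
      show "continuous_map (subtopology (top_of_set {a..d}) {x \<in> topspace (top_of_set {a..d}). x \<le> b}) (points M) \<gamma>"
        unfolding * using curve by (simp add: timelike_curve_def)
      show "continuous_map (subtopology (top_of_set {a..d}) {x \<in> topspace (top_of_set {a..d}). b \<le> x}) (points M) \<sigma>"
        unfolding * using arc by (simp add: timelike_arc_def)
    qed (use xy yz in auto)
  next
    fix i assume "i < Suc n"
    have "\<exists>V. timelike_arc M (\<tau>' i) (\<tau>' (Suc i)) \<delta> V"
    proof (cases "i < n")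
      case True
      then have "timelike_arc M (\<tau> i) (\<tau> (Suc i)) \<gamma> (velocity (atlas M) {\<tau> i..\<tau> (Suc i)} \<gamma>)"
        using pieces timelike_arc_velocity by blast
      then have "timelike_arc M (\<tau> i) (\<tau> (Suc i)) \<delta> (velocity (atlas M) {\<tau> i..\<tau> (Suc i)} \<gamma>)"
        using mono[of "Suc i"] True by (elim timelike_arc_cong) (auto simp: \<delta>_def)
      then show ?thesis
        using True by (auto simp: \<tau>'_def)
    next
      case False
      then have "i = n"
        using \<open>i < Suc n\<close> by simp
      then show ?thesis
        using timelike_arc_cong[OF arc \<delta>_\<sigma>] \<tau> by (auto simp: \<tau>'_def)
    qed
    then obtain V where V: "timelike_arc M (\<tau>' i) (\<tau>' (Suc i)) \<delta> V" ..
    show "\<tau>' i < \<tau>' (Suc i)" "C1_curve M {\<tau>' i..\<tau>' (Suc i)} \<delta>"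
      "\<forall>t\<in>{\<tau>' i..\<tau>' (Suc i)}. future_timelike M (\<delta> t) (velocity (atlas M) {\<tau>' i..\<tau>' (Suc i)} \<delta> t)"
      using V timelike_arc_C1[OF V] by (auto simp: timelike_arc_def)
  qed
  moreover have "\<delta> a = x" "\<delta> d = z"
    using \<open>a < b\<close> \<open>b < d\<close> xy yz by (auto simp: \<delta>_def)
  ultimately show ?thesis
    by (auto simp: chronological_def)
qed

lemma chronological_eq_tranclp: "chronological M = (arc_related M)\<^sup>+\<^sup>+"
proof (intro ext iffI)
  fix x y assume "(arc_related M)\<^sup>+\<^sup>+ x y"
  then show "chronological M x y"
    by induction (blast intro: arc_related_imp_chronological chronological_append_arc)+
qed (rule chronological_imp_tranclp)

section \<open>Charts of a spacetime\<close>

abbreviation transition :: "('a, 'e::euclidean_space) chart \<Rightarrow> ('a, 'e) chart \<Rightarrow> 'e \<Rightarrow> 'e" where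
  "transition c c' \<equiv> coords c' \<circ> chart_inv c"

lemma smooth_on_imp_continuous_on:
  assumes "smooth_on f S"
  shows "continuous_on S f"
proof -
  have "ck_on 0 f S"
    using assms unfolding smooth_on_def ..
  then show ?thesis
    by simp
qed

lemma smooth_on_imp_C1:
  assumes "smooth_on f S"
  shows "x \<in> S \<Longrightarrow> f differentiable at x"
    and "continuous_on S (\<lambda>x. frechet_derivative f (at x) u)"
proof -
  have "ck_on (Suc 0) f S"
    using assms unfolding smooth_on_def ..
  then show "x \<in> S \<Longrightarrow> f differentiable at x"
    and "continuous_on S (\<lambda>x. frechet_derivative f (at x) u)"
    by simp_all
qed

lemma linear_eq_sum_Basis:
  fixes f :: "'e::euclidean_space \<Rightarrow> real"
  assumes "linear f"
  shows "f u = (\<Sum>i\<in>Basis. (u \<bullet> i) * f i)"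
proof -
  have "f u = f (\<Sum>i\<in>Basis. (u \<bullet> i) *\<^sub>R i)"
    by (simp only: euclidean_representation)
  also have "\<dots> = (\<Sum>i\<in>Basis. f ((u \<bullet> i) *\<^sub>R i))"
    by (rule linear_sum[OF assms])
  finally show ?thesis
    by (simp only: linear_scale[OF assms] real_scaleR_def)
qed

locale chronological_spacetime =
  fixes M :: "('a, 'e::euclidean_space) spacetime"
  assumes spacetime: "smooth_spacetime M"
begin

abbreviation "chart_image c \<equiv> coords c ` chart_dom c"

lemma manifold: "smooth_manifold (points M) (atlas M)"
  and metric: "lorentzian_metric M"
  and orientation: "time_orientation M"
  using spacetime by (simp_all add: smooth_spacetime_def)

lemma
  assumes "c \<in> atlas M"
  shows chart_dom_open: "openin (points M) (chart_dom c)"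
    and chart_dom_subset: "chart_dom c \<subseteq> topspace (points M)"
    and chart_image_open: "open (chart_image c)"
    and chart_homeo: "homeomorphic_map (subtopology (points M) (chart_dom c)) (top_of_set (chart_image c)) (coords c)"
    and chart_inj: "inj_on (coords c) (chart_dom c)"
proof -
  have "is_chart (points M) c"
    using manifold assms unfolding smooth_manifold_def by simp
  then show *: "openin (points M) (chart_dom c)" "open (chart_image c)"
    "homeomorphic_map (subtopology (points M) (chart_dom c)) (top_of_set (chart_image c)) (coords c)"
    by (simp_all add: is_chart_def)
  then show sub: "chart_dom c \<subseteq> topspace (points M)"
    by (simp add: openin_subset)
  then have "topspace (subtopology (points M) (chart_dom c)) = chart_dom c"
    by (simp add: Int_absorb1)
  then show "inj_on (coords c) (chart_dom c)"
    using homeomorphic_imp_injective_map[OF *(3)] by simp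
qed

lemma chart_inv_coords: "c \<in> atlas M \<Longrightarrow> p \<in> chart_dom c \<Longrightarrow> chart_inv c (coords c p) = p"
  unfolding chart_inv_def using chart_inj by (rule inv_into_f_f)

lemma chart_inv_mem: "x \<in> chart_image c \<Longrightarrow> chart_inv c x \<in> chart_dom c"
  unfolding chart_inv_def by (rule inv_into_into)

lemma coords_chart_inv: "x \<in> chart_image c \<Longrightarrow> coords c (chart_inv c x) = x"
  unfolding chart_inv_def by (rule f_inv_into_f)

lemma coords_continuous:
  "c \<in> atlas M \<Longrightarrow> continuous_map (subtopology (points M) (chart_dom c)) euclidean (coords c)"
  by (rule continuous_map_into_fulltopology[OF homeomorphic_imp_continuous_map[OF chart_homeo]])

lemma open_coords_vimage:
  assumes "c \<in> atlas M" "open S"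
  shows "openin (points M) {q \<in> chart_dom c. coords c q \<in> S}"
proof -
  have "openin (subtopology (points M) (chart_dom c))
      {q \<in> topspace (subtopology (points M) (chart_dom c)). coords c q \<in> S}"
    using coords_continuous[OF assms(1)] assms(2)
    by (intro openin_continuous_map_preimage[where Y = euclidean]) simp_all
  moreover have "topspace (subtopology (points M) (chart_dom c)) = chart_dom c"
    using chart_dom_subset[OF assms(1)] by (simp add: Int_absorb1)
  ultimately show ?thesis
    using openin_trans_full chart_dom_open[OF assms(1)] by fastforce
qed

lemma open_coords_image:
  assumes "c \<in> atlas M" "openin (points M) U"
  shows "open (coords c ` (chart_dom c \<inter> U))"
proof -
  have "openin (subtopology (points M) (chart_dom c)) (chart_dom c \<inter> U)"
    using assms(2) openin_subtopology_Int by (metis inf_commute)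
  then have "openin (top_of_set (chart_image c)) (coords c ` (chart_dom c \<inter> U))"
    using homeomorphic_imp_open_map[OF chart_homeo[OF assms(1)]] unfolding open_map_def by blast
  then show ?thesis
    using chart_image_open[OF assms(1)] openin_open_eq by blast
qed

lemma chart_inv_continuous:
  assumes "c \<in> atlas M"
  shows "continuous_map (top_of_set (chart_image c)) (points M) (chart_inv c)"
  unfolding continuous_map
proof (intro conjI allI impI)
  show "chart_inv c ` topspace (top_of_set (chart_image c)) \<subseteq> topspace (points M)"
    using chart_inv_mem[of _ c] subsetD[OF chart_dom_subset[OF assms]] by (simp add: image_subset_iff)
  fix U assume U: "openin (points M) U"
  have "{x \<in> topspace (top_of_set (chart_image c)). chart_inv c x \<in> U} = coords c ` (chart_dom c \<inter> U)"
    using chart_inv_coords[OF assms] by (auto simp del: comp_apply)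
  then show "openin (top_of_set (chart_image c)) {x \<in> topspace (top_of_set (chart_image c)). chart_inv c x \<in> U}"
    using open_coords_image[OF assms U] by (simp add: openin_open_eq[OF chart_image_open[OF assms]] image_mono)
qed

lemma charts_cover:
  assumes "p \<in> topspace (points M)"
  obtains c where "c \<in> atlas M" "p \<in> chart_dom c"
proof -
  have "p \<in> (\<Union>c\<in>atlas M. chart_dom c)"
    using manifold assms unfolding smooth_manifold_def by simp
  then show thesis
    using that by blast
qed

section \<open>Transition maps and tangent vectors in coordinates\<close>

lemma transition_smooth:
  assumes "c \<in> atlas M" "c' \<in> atlas M"
  shows "smooth_on (transition c c') (coords c ` (chart_dom c \<inter> chart_dom c'))"
  using manifold assms unfolding smooth_manifold_def by blast

lemma transition_derivative:
  assumes "c \<in> atlas M" "c' \<in> atlas M" "p \<in> chart_dom c" "p \<in> chart_dom c'"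
  shows "(transition c c' has_derivative frechet_derivative (transition c c') (at (coords c p))) (at (coords c p))"
  using smooth_on_imp_C1(1)[OF transition_smooth[OF assms(1,2)]] assms(3,4)
  unfolding frechet_derivative_works by blast

text \<open>The chain rule. The composite of two transition maps agrees with the third only on the
  image of the triple overlap, but that image is open, so the derivatives coincide.\<close>

lemma transition_cocycle:
  assumes "c \<in> atlas M" "c' \<in> atlas M" "c'' \<in> atlas M"
    and "p \<in> chart_dom c" "p \<in> chart_dom c'" "p \<in> chart_dom c''"
  shows "frechet_derivative (transition c c'') (at (coords c p)) u =
    frechet_derivative (transition c' c'') (at (coords c' p))
      (frechet_derivative (transition c c') (at (coords c p)) u)"
proof -
  let ?S = "coords c ` (chart_dom c \<inter> (chart_dom c' \<inter> chart_dom c''))"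
  have p: "transition c c' (coords c p) = coords c' p"
    using assms chart_inv_coords by simp
  have "(transition c' c'' \<circ> transition c c' has_derivative
      frechet_derivative (transition c' c'') (at (coords c' p)) \<circ>
      frechet_derivative (transition c c') (at (coords c p))) (at (coords c p))"
    using transition_derivative[OF assms(1,2,4,5)] transition_derivative[OF assms(2,3,5,6)]
    unfolding p[symmetric] by (rule diff_chain_at)
  then have "(transition c c'' has_derivative
      frechet_derivative (transition c' c'') (at (coords c' p)) \<circ>
      frechet_derivative (transition c c') (at (coords c p))) (at (coords c p))"
  proof (rule has_derivative_transform_within_open)
    show "open ?S"
      using assms chart_dom_open by (intro open_coords_image openin_Int) auto
    show "coords c p \<in> ?S"
      using assms by auto
    show "(transition c' c'' \<circ> transition c c') x = transition c c'' x" if "x \<in> ?S" for x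
      using that chart_inv_coords[OF assms(1)] chart_inv_coords[OF assms(2)] by auto
  qed
  from frechet_derivative_at[OF this] show ?thesis
    by (metis comp_apply)
qed

text \<open>The compatibility demanded of a tangent vector is precisely the cocycle rule.\<close>

lemma coord_vector_tangent:
  assumes "c \<in> atlas M" "p \<in> chart_dom c"
  shows "coord_vector (atlas M) c p u \<in> tangents M p"
  unfolding tangent_space_def
proof (intro CollectI conjI allI ballI impI)
  fix c' c'' assume c': "c' \<in> atlas M" "c'' \<in> atlas M" "p \<in> chart_dom c' \<inter> chart_dom c''"
  then show "coord_vector (atlas M) c p u c'' =
      frechet_derivative (transition c' c'') (at (coords c' p)) (coord_vector (atlas M) c p u c')"
    unfolding coord_vector_def
    by (simp add: transition_cocycle[OF assms(1) c'(1,2) assms(2), of u])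
qed (simp only: coord_vector_def if_False)

text \<open>With \<open>coord_vector_tangent\<close>, this identifies the tangent space at
  \<open>p\<close> with the model space through one chart, so that conditions on tangent vectors
  become conditions on coordinates.\<close>

lemma tangent_eq_coord_vector:
  assumes "v \<in> tangents M p" "c \<in> atlas M" "p \<in> chart_dom c"
  shows "v = coord_vector (atlas M) c p (v c)"
proof
  fix c'
  show "v c' = coord_vector (atlas M) c p (v c) c'"
  proof (cases "c' \<in> atlas M \<and> p \<in> chart_dom c'")
    case True
    then have "v c' = frechet_derivative (transition c c') (at (coords c p)) (v c)"
      using assms unfolding tangent_space_def by blast
    then show ?thesis
      using True by (simp add: coord_vector_def)
  next
    case False
    then show ?thesis
      using tangent_eq_0[OF assms(1) False] unfolding coord_vector_def by (simp only: False if_False)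
  qed
qed

lemma
  assumes "c \<in> atlas M" "p \<in> chart_dom c"
  shows coord_vector_add: "coord_vector (atlas M) c p (u + w) =
      tangent_add (coord_vector (atlas M) c p u) (coord_vector (atlas M) c p w)"
    and coord_vector_scale: "coord_vector (atlas M) c p (r *\<^sub>R u) =
      tangent_scale r (coord_vector (atlas M) c p u)"
proof -
  have lin: "linear (frechet_derivative (transition c c') (at (coords c p)))"
    if "c' \<in> atlas M" "p \<in> chart_dom c'" for c'
    using transition_derivative[OF assms(1) that(1) assms(2) that(2)] by (rule has_derivative_linear)
  show "coord_vector (atlas M) c p (u + w) =
      tangent_add (coord_vector (atlas M) c p u) (coord_vector (atlas M) c p w)"
    by (rule ext) (simp add: coord_vector_def tangent_add_def linear_add[OF lin])
  show "coord_vector (atlas M) c p (r *\<^sub>R u) = tangent_scale r (coord_vector (atlas M) c p u)"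
    by (rule ext) (simp add: coord_vector_def tangent_scale_def linear_scale[OF lin])
qed

section \<open>The metric and the time cones in coordinates\<close>

definition local_metric :: "('a, 'e) chart \<Rightarrow> 'e \<Rightarrow> 'e \<Rightarrow> 'e \<Rightarrow> real" where
  "local_metric c x u w =
     metric M (chart_inv c x) (coord_vector (atlas M) c (chart_inv c x) u)
       (coord_vector (atlas M) c (chart_inv c x) w)"

lemma
  assumes "p \<in> topspace (points M)" "v \<in> tangents M p" "w \<in> tangents M p"
  shows metric_sym: "metric M p v w = metric M p w v"
    and metric_add: "v' \<in> tangents M p \<Longrightarrow>
      metric M p (tangent_add v v') w = metric M p v w + metric M p v' w"
    and metric_scale: "metric M p (tangent_scale r v) w = r * metric M p v w"
proof -
  note g = metric[unfolded lorentzian_metric_def, THEN conjunct1, THEN bspec, OF assms(1)]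
  show "metric M p v w = metric M p w v"
    by (rule g[THEN conjunct1, THEN bspec, THEN bspec, OF assms(2,3)])
  show "metric M p (tangent_add v v') w = metric M p v w + metric M p v' w" if "v' \<in> tangents M p"
    by (rule g[THEN conjunct2, THEN conjunct1, THEN bspec, THEN bspec, THEN bspec, OF assms(2) that assms(3)])
  show "metric M p (tangent_scale r v) w = r * metric M p v w"
    by (rule g[THEN conjunct2, THEN conjunct2, THEN conjunct1, THEN spec, THEN bspec, THEN bspec, OF assms(2,3)])
qed

lemma local_metric_bilinear:
  assumes "c \<in> atlas M" "x \<in> chart_image c"
  shows "linear (\<lambda>u. local_metric c x u w)" "linear (local_metric c x u)"
proof -
  have p: "chart_inv c x \<in> chart_dom c" "chart_inv c x \<in> topspace (points M)"
    using chart_inv_mem[OF assms(2)] chart_dom_subset[OF assms(1)] by auto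
  have sym: "local_metric c x u w = local_metric c x w u" for u w
    unfolding local_metric_def
    by (intro metric_sym coord_vector_tangent p assms)
  show *: "linear (\<lambda>u. local_metric c x u w)" for w
    by (rule linearI)
      (simp_all add: local_metric_def coord_vector_add[OF assms(1) p(1)]
        coord_vector_scale[OF assms(1) p(1)] metric_add[OF p(2)] metric_scale[OF p(2)]
        coord_vector_tangent[OF assms(1) p(1)])
  show "linear (local_metric c x u)"
    unfolding ext[of "local_metric c x u" "\<lambda>w. local_metric c x w u", OF sym] by (rule *)
qed

lemma local_metric_expand:
  assumes "c \<in> atlas M" "x \<in> chart_image c"
  shows "local_metric c x u w = (\<Sum>i\<in>Basis. \<Sum>j\<in>Basis. (u \<bullet> i) * (w \<bullet> j) * local_metric c x i j)"
proof -
  note lin = local_metric_bilinear[OF assms]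
  have "local_metric c x u w = (\<Sum>i\<in>Basis. (u \<bullet> i) * local_metric c x i w)"
    by (rule linear_eq_sum_Basis[where f = "\<lambda>u. local_metric c x u w", OF lin(1)])
  also have "\<dots> = (\<Sum>i\<in>Basis. (u \<bullet> i) * (\<Sum>j\<in>Basis. (w \<bullet> j) * local_metric c x i j))"
    by (simp only: linear_eq_sum_Basis[where f = "local_metric c x _" and u = w, OF lin(2)])
  finally show ?thesis
    by (simp only: sum_distrib_left mult.assoc)
qed

text \<open>The smoothness assumption concerns constant coordinate vectors only, that is, the metric
  coefficients. Expanding over the basis gives a finite sum of products, which is continuous in the
  point and both vectors jointly.\<close>

lemma local_metric_continuous:
  assumes "c \<in> atlas M" "continuous_on T x" "continuous_on T u" "continuous_on T w"
    and "x ` T \<subseteq> chart_image c"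
  shows "continuous_on T (\<lambda>t. local_metric c (x t) (u t) (w t))"
proof -
  have "continuous_on (chart_image c) (\<lambda>x. local_metric c x i j)" for i j
    using metric[unfolded lorentzian_metric_def Let_def, THEN conjunct2, THEN bspec, OF assms(1),
        THEN spec, THEN spec]
    unfolding local_metric_def by (rule smooth_on_imp_continuous_on)
  then have entry: "continuous_on T (\<lambda>t. local_metric c (x t) i j)" for i j
    using assms(2,5)
    by (rule continuous_on_compose2[where g = "\<lambda>y. local_metric c y i j" and f = x])
  have "continuous_on T (\<lambda>t. \<Sum>i\<in>Basis. \<Sum>j\<in>Basis. (u t \<bullet> i) * (w t \<bullet> j) * local_metric c (x t) i j)"
    by (intro continuous_on_sum continuous_on_mult continuous_on_inner continuous_on_const entry assms(3,4))
  then show ?thesis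
  proof (rule continuous_on_eq)
    fix t assume "t \<in> T"
    then show "(\<Sum>i\<in>Basis. \<Sum>j\<in>Basis. (u t \<bullet> i) * (w t \<bullet> j) * local_metric c (x t) i j) =
        local_metric c (x t) (u t) (w t)"
      using assms by (intro local_metric_expand[symmetric]) auto
  qed
qed

text \<open>For the orientation vector itself the two inequalities in \<open>future_timelike\<close>
  coincide. This provides a future timelike vector at every point.\<close>

lemma orientation_tangent:
  "p \<in> topspace (points M) \<Longrightarrow> future_timelike M p (orientation M p)"
  using orientation unfolding time_orientation_def future_timelike_def timelike_def by simp

text \<open>In coordinates the condition says that two functions of the point and the vector are
  negative. Both are continuous, the second because the orientation field is, so the condition holds
  on a product of two balls; the smaller radius serves for both.\<close>

lemma future_timelike_nhds:
  assumes c: "c \<in> atlas M" "p \<in> chart_dom c" and v: "future_timelike M p v"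
  obtains \<epsilon> where "\<epsilon> > 0" "ball (coords c p) \<epsilon> \<subseteq> chart_image c"
    and "\<And>x w. x \<in> ball (coords c p) \<epsilon> \<Longrightarrow> w \<in> ball (v c) \<epsilon> \<Longrightarrow>
      future_timelike M (chart_inv c x) (coord_vector (atlas M) c (chart_inv c x) w)"
proof -
  define o' where "o' = (\<lambda>x. orientation M (chart_inv c x) c)"
  let ?S = "chart_image c \<times> UNIV"
  let ?f = "\<lambda>(x, w). local_metric c x w w"
  let ?h = "\<lambda>(x, w). local_metric c x (o' x) w"
  have o': "orientation M (chart_inv c x) = coord_vector (atlas M) c (chart_inv c x) (o' x)"
    if "x \<in> chart_image c" for x
    unfolding o'_def
    using chart_inv_mem[OF that] chart_dom_subset[OF c(1)]
    by (intro tangent_eq_coord_vector future_timelike_tangent orientation_tangent c(1)) auto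
  have "continuous_map (top_of_set (chart_image c)) (subtopology (points M) (chart_dom c)) (chart_inv c)"
    using chart_inv_continuous[OF c(1)] chart_inv_mem[of _ c]
    by (intro continuous_map_into_subtopology) (auto simp: Pi_iff)
  moreover have "continuous_map (subtopology (points M) (chart_dom c)) euclidean (\<lambda>p. orientation M p c)"
    using orientation c(1) unfolding time_orientation_def by simp
  ultimately have "continuous_map (top_of_set (chart_image c)) euclidean ((\<lambda>p. orientation M p c) \<circ> chart_inv c)"
    by (rule continuous_map_compose)
  then have "continuous_on (chart_image c) o'"
    unfolding o'_def by (simp add: comp_def)
  then have cont_o': "continuous_on ?S (\<lambda>z. o' (fst z))"
    by (intro continuous_on_compose2[where g = o' and f = fst] continuous_on_fst continuous_on_id) auto
  have f: "continuous_on ?S ?f"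
    unfolding case_prod_unfold
    by (rule local_metric_continuous[OF c(1) continuous_on_fst continuous_on_snd continuous_on_snd])
      (simp_all add: image_subset_iff)
  have h: "continuous_on ?S ?h"
    unfolding case_prod_unfold
    by (rule local_metric_continuous[OF c(1) continuous_on_fst cont_o' continuous_on_snd])
      (simp_all add: image_subset_iff)
  have "open ?S"
    using chart_image_open[OF c(1)] by (intro open_Times) auto
  then have "open (?S \<inter> ?f -` {..<0})" "open (?S \<inter> ?h -` {..<0})"
    using continuous_open_preimage[OF f _ open_lessThan] continuous_open_preimage[OF h _ open_lessThan]
    by blast+
  then have "open (?S \<inter> ?f -` {..<0} \<inter> (?S \<inter> ?h -` {..<0}))"
    by (rule open_Int)
  moreover have "(coords c p, v c) \<in> ?S \<inter> ?f -` {..<0} \<inter> (?S \<inter> ?h -` {..<0})"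
  proof -
    have "v = coord_vector (atlas M) c p (v c)"
      using tangent_eq_coord_vector[OF future_timelike_tangent[OF v] c] .
    moreover have "orientation M p = coord_vector (atlas M) c p (o' (coords c p))"
      using o'[of "coords c p"] c chart_inv_coords[OF c] by simp
    ultimately show ?thesis
      using v c chart_inv_coords[OF c]
      by (simp add: local_metric_def future_timelike_def timelike_def)
  qed
  ultimately obtain A B where AB: "open A" "open B" "coords c p \<in> A" "v c \<in> B"
    "A \<times> B \<subseteq> ?S \<inter> ?f -` {..<0} \<inter> (?S \<inter> ?h -` {..<0})"
    by (rule open_prod_elim) auto
  obtain e1 where e1: "e1 > 0" "ball (coords c p) e1 \<subseteq> A"
    using AB(1,3) open_contains_ball by blast
  obtain e2 where e2: "e2 > 0" "ball (v c) e2 \<subseteq> B"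
    using AB(2,4) open_contains_ball by blast
  show thesis
  proof
    show "min e1 e2 > 0"
      using e1 e2 by simp
    show "ball (coords c p) (min e1 e2) \<subseteq> chart_image c"
    proof
      fix x assume "x \<in> ball (coords c p) (min e1 e2)"
      then have "(x, v c) \<in> A \<times> B"
        using e1 AB(4) by auto
      then show "x \<in> chart_image c"
        using AB(5) by blast
    qed
    fix x w assume "x \<in> ball (coords c p) (min e1 e2)" "w \<in> ball (v c) (min e1 e2)"
    then have "(x, w) \<in> A \<times> B"
      using e1 e2 by auto
    then have "x \<in> chart_image c" "local_metric c x w w < 0" "local_metric c x (o' x) w < 0"
      using AB(5) by auto
    then show "future_timelike M (chart_inv c x) (coord_vector (atlas M) c (chart_inv c x) w)"
      using o'[of x] chart_inv_mem[of x c] coord_vector_tangent[OF c(1)]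
      by (simp add: local_metric_def future_timelike_def timelike_def)
  qed
qed

section \<open>Openness of the chronology\<close>

text \<open>A line with coordinate velocity \<open>w\<close> in \<open>c\<close> has, by the chain
  rule, the velocity in any other chart given by the Jacobian of the transition map applied to
  \<open>w\<close>; this is how \<open>coord_vector\<close> is defined.\<close>

lemma timelike_arc_segment:
  assumes c: "c \<in> atlas M" and "0 < s"
    and S: "\<And>t. t \<in> {0..s} \<Longrightarrow> x + t *\<^sub>R w \<in> chart_image c"
    and future: "\<And>t. t \<in> {0..s} \<Longrightarrow>
      future_timelike M (chart_inv c (x + t *\<^sub>R w)) (coord_vector (atlas M) c (chart_inv c (x + t *\<^sub>R w)) w)"
  shows "timelike_arc M 0 s (\<lambda>t. chart_inv c (x + t *\<^sub>R w))
    (\<lambda>t. coord_vector (atlas M) c (chart_inv c (x + t *\<^sub>R w)) w)"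
proof (rule timelike_arcI)
  have "continuous_map (top_of_set {0..s}) (top_of_set (chart_image c)) (\<lambda>t. x + t *\<^sub>R w)"
    using S by (auto intro!: continuous_intros simp del: atLeastAtMost_iff)
  from continuous_map_compose[OF this chart_inv_continuous[OF c]]
  show "continuous_map (top_of_set {0..s}) (points M) (\<lambda>t. chart_inv c (x + t *\<^sub>R w))"
    by (simp add: comp_def)
next
  fix c' t assume c': "c' \<in> atlas M" and t: "t \<in> {0..s}" "chart_inv c (x + t *\<^sub>R w) \<in> chart_dom c'"
  have p: "chart_inv c (x + t *\<^sub>R w) \<in> chart_dom c"
    using S[OF t(1)] by (rule chart_inv_mem)
  have "(transition c c' has_derivative frechet_derivative (transition c c') (at (x + t *\<^sub>R w))) (at (x + t *\<^sub>R w))"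
    using transition_derivative[OF c c' p t(2)] unfolding coords_chart_inv[OF S[OF t(1)]] .
  then have "(transition c c' has_derivative frechet_derivative (transition c c') (at (x + t *\<^sub>R w)))
      (at (x + t *\<^sub>R w) within (\<lambda>t. x + t *\<^sub>R w) ` {0..s})"
    by (rule has_derivative_at_withinI)
  moreover have "((\<lambda>t. x + t *\<^sub>R w) has_vector_derivative w) (at t within {0..s})"
    by (auto intro!: derivative_eq_intros)
  ultimately have "(transition c c' \<circ> (\<lambda>t. x + t *\<^sub>R w) has_vector_derivative
      frechet_derivative (transition c c') (at (x + t *\<^sub>R w)) w) (at t within {0..s})"
    by (intro vector_derivative_diff_chain_within)
  then show "(coords c' \<circ> (\<lambda>t. chart_inv c (x + t *\<^sub>R w)) has_vector_derivative
      coord_vector (atlas M) c (chart_inv c (x + t *\<^sub>R w)) w c') (at t within {0..s})"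
    using c' t(2) coords_chart_inv[OF S[OF t(1)]] by (simp add: coord_vector_def comp_def)
next
  fix c' assume c': "c' \<in> atlas M"
  let ?T = "{t \<in> {0..s}. chart_inv c (x + t *\<^sub>R w) \<in> chart_dom c'}"
  have "continuous_on ?T (\<lambda>t. frechet_derivative (transition c c') (at (x + t *\<^sub>R w)) w)"
  proof (rule continuous_on_compose2[where f = "\<lambda>t. x + t *\<^sub>R w"])
    show "continuous_on (coords c ` (chart_dom c \<inter> chart_dom c'))
        (\<lambda>y. frechet_derivative (transition c c') (at y) w)"
      by (rule smooth_on_imp_C1(2)[OF transition_smooth[OF c c']])
    show "(\<lambda>t. x + t *\<^sub>R w) ` ?T \<subseteq> coords c ` (chart_dom c \<inter> chart_dom c')"
    proof (rule image_subsetI)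
      fix t assume t: "t \<in> ?T"
      then have "x + t *\<^sub>R w \<in> chart_image c"
        using S by blast
      then show "x + t *\<^sub>R w \<in> coords c ` (chart_dom c \<inter> chart_dom c')"
        using coords_chart_inv[of "x + t *\<^sub>R w" c] chart_inv_mem[of "x + t *\<^sub>R w" c] t
        by (intro image_eqI[of _ _ "chart_inv c (x + t *\<^sub>R w)"]) simp_all
    qed
  qed (intro continuous_intros)
  then show "continuous_on ?T (\<lambda>t. coord_vector (atlas M) c (chart_inv c (x + t *\<^sub>R w)) w c')"
  proof (rule continuous_on_eq)
    fix t assume "t \<in> ?T"
    then show "frechet_derivative (transition c c') (at (x + t *\<^sub>R w)) w =
        coord_vector (atlas M) c (chart_inv c (x + t *\<^sub>R w)) w c'"
      using c' coords_chart_inv[OF S[of t]] by (simp add: coord_vector_def)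
  qed
qed (fact \<open>0 < s\<close>, fact future)

text \<open>The straight segment from \<open>q\<close> to \<open>r\<close>, traversed in time
  \<open>s\<close>, stays in the ball by convexity. The norm condition says that its constant
  velocity is within \<open>\<epsilon>\<close> of \<open>v c\<close>; multiplied by
  \<open>s\<close>, it has the form of a first-order approximation error.\<close>

lemma segments_near_timelike:
  assumes c: "c \<in> atlas M" "p \<in> chart_dom c" and v: "future_timelike M p v"
  obtains \<epsilon> where "\<epsilon> > 0" "ball (coords c p) \<epsilon> \<subseteq> chart_image c"
    and "\<And>q r s. q \<in> chart_dom c \<Longrightarrow> r \<in> chart_dom c \<Longrightarrow> coords c q \<in> ball (coords c p) \<epsilon> \<Longrightarrow>
      coords c r \<in> ball (coords c p) \<epsilon> \<Longrightarrow> 0 < s \<Longrightarrow>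
      norm (coords c r - coords c q - s *\<^sub>R v c) < s * \<epsilon> \<Longrightarrow> arc_related M q r"
proof -
  obtain \<epsilon> where \<epsilon>: "\<epsilon> > 0" "ball (coords c p) \<epsilon> \<subseteq> chart_image c"
    and future: "\<And>x w. x \<in> ball (coords c p) \<epsilon> \<Longrightarrow> w \<in> ball (v c) \<epsilon> \<Longrightarrow>
      future_timelike M (chart_inv c x) (coord_vector (atlas M) c (chart_inv c x) w)"
    by (rule future_timelike_nhds[OF c v]) (rule that; blast)
  have "arc_related M q r" if qr: "q \<in> chart_dom c" "r \<in> chart_dom c"
    and ball: "coords c q \<in> ball (coords c p) \<epsilon>" "coords c r \<in> ball (coords c p) \<epsilon>"
    and s: "0 < s" "norm (coords c r - coords c q - s *\<^sub>R v c) < s * \<epsilon>" for q r s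
  proof -
    define w where "w = (1 / s) *\<^sub>R (coords c r - coords c q)"
    have sw: "s *\<^sub>R w = coords c r - coords c q"
      using s by (simp add: w_def)
    have "s * norm (w - v c) = norm (s *\<^sub>R (w - v c))"
      using s by simp
    also have "\<dots> < s * \<epsilon>"
      using s by (simp only: scaleR_diff_right sw)
    finally have w: "w \<in> ball (v c) \<epsilon>"
      using s by (simp add: dist_norm norm_minus_commute)
    have line: "coords c q + t *\<^sub>R w \<in> ball (coords c p) \<epsilon>" if "t \<in> {0..s}" for t
    proof -
      have "coords c q + t *\<^sub>R w = (1 - t / s) *\<^sub>R coords c q + (t / s) *\<^sub>R coords c r"
        using s by (simp add: w_def algebra_simps)
      then show ?thesis
        using convexD[OF convex_ball ball, of "1 - t / s" "t / s"] that s by simp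
    qed
    have "timelike_arc M 0 s (\<lambda>t. chart_inv c (coords c q + t *\<^sub>R w))
        (\<lambda>t. coord_vector (atlas M) c (chart_inv c (coords c q + t *\<^sub>R w)) w)"
      using line \<epsilon>(2) by (intro timelike_arc_segment c(1) s(1) future[OF _ w]) blast+
    moreover have "chart_inv c (coords c q + 0 *\<^sub>R w) = q" "chart_inv c (coords c q + s *\<^sub>R w) = r"
      by (simp_all add: sw chart_inv_coords[OF c(1)] qr)
    ultimately show ?thesis
      unfolding arc_related_def by blast
  qed
  then show thesis
    using that[OF \<epsilon>] by blast
qed

text \<open>By differentiability at the end point, a nearby \<open>\<gamma> t\<close> lies almost in
  the direction of the velocity there. This survives a small displacement of the end point, so the
  last bit of the arc can be replaced by a segment to any nearby \<open>q\<close>. The parameter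
  \<open>e\<close> covers both ends of the arc at once.\<close>

lemma timelike_arc_endpoint:
  assumes arc: "timelike_arc M a b \<gamma> V" and e: "e \<in> {a, b}"
  obtains U t where "openin (points M) U" "\<gamma> e \<in> U" "a < t" "t < b"
    and "\<And>q. q \<in> U \<Longrightarrow> if e = b then arc_related M (\<gamma> t) q else arc_related M q (\<gamma> t)"
proof -
  have "a < b" and e': "e \<in> {a..b}"
    using timelike_arcD(1)[OF arc] e by auto
  have "\<gamma> e \<in> topspace (points M)"
    using timelike_arcD(2)[OF arc] e' by (auto simp: continuous_map_def Pi_iff)
  then obtain c where c: "c \<in> atlas M" "\<gamma> e \<in> chart_dom c"
    by (rule charts_cover)
  obtain \<epsilon> where \<epsilon>: "\<epsilon> > 0" "ball (coords c (\<gamma> e)) \<epsilon> \<subseteq> chart_image c"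
    and segment: "\<And>q r s. q \<in> chart_dom c \<Longrightarrow> r \<in> chart_dom c \<Longrightarrow>
      coords c q \<in> ball (coords c (\<gamma> e)) \<epsilon> \<Longrightarrow> coords c r \<in> ball (coords c (\<gamma> e)) \<epsilon> \<Longrightarrow> 0 < s \<Longrightarrow>
      norm (coords c r - coords c q - s *\<^sub>R V e c) < s * \<epsilon> \<Longrightarrow> arc_related M q r"
    by (rule segments_near_timelike[OF c timelike_arcD(5)[OF arc e']]) (rule that; blast)
  let ?N = "\<lambda>\<eta>. {q \<in> chart_dom c. coords c q \<in> ball (coords c (\<gamma> e)) \<eta>}"
  have "openin (top_of_set {a..b}) {t \<in> topspace (top_of_set {a..b}). \<gamma> t \<in> ?N \<epsilon>}"
    by (rule openin_continuous_map_preimage[OF timelike_arcD(2)[OF arc]])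
      (rule open_coords_vimage[OF c(1) open_ball])
  moreover have "e \<in> {t \<in> topspace (top_of_set {a..b}). \<gamma> t \<in> ?N \<epsilon>}"
    using e' c(2) \<epsilon>(1) by simp
  ultimately obtain d1 where d1: "d1 > 0" "ball e d1 \<inter> {a..b} \<subseteq> {t \<in> topspace (top_of_set {a..b}). \<gamma> t \<in> ?N \<epsilon>}"
    unfolding openin_contains_ball by blast
  have "((coords c \<circ> \<gamma>) has_derivative (\<lambda>h. h *\<^sub>R V e c)) (at e within {a..b})"
    using timelike_arcD(3)[OF arc c(1) e' c(2)] by (simp add: has_vector_derivative_def)
  \<comment> \<open>Half of the tolerance \<open>\<epsilon>\<close> is spent on the linear
    approximation; the other half is left for displacing the end point.\<close>
  then have "\<exists>d>0. \<forall>t\<in>{a..b}. norm (t - e) < d \<longrightarrow>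
      norm ((coords c \<circ> \<gamma>) t - (coords c \<circ> \<gamma>) e - (t - e) *\<^sub>R V e c) \<le> \<epsilon> / 2 * norm (t - e)"
    unfolding has_derivative_within_alt by (elim conjE allE[of _ "\<epsilon> / 2"]) (simp only: half_gt_zero[OF \<epsilon>(1)] simp_thms)
  then obtain d2 where d2: "d2 > 0" "\<And>t. t \<in> {a..b} \<Longrightarrow> norm (t - e) < d2 \<Longrightarrow>
      norm ((coords c \<circ> \<gamma>) t - (coords c \<circ> \<gamma>) e - (t - e) *\<^sub>R V e c) \<le> \<epsilon> / 2 * norm (t - e)"
    by blast
  define h where "h = min (min d1 d2) (b - a) / 2"
  have h: "0 < h" "h < d1" "h < d2" "h < b - a"
    using d1(1) d2(1) \<open>a < b\<close> by (auto simp: h_def)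
  define t where "t = (if e = b then b - h else a + h)"
  have t: "a < t" "t < b" "\<bar>t - e\<bar> = h"
    using e h by (auto simp: t_def)
  then have t': "t \<in> {a..b}" "t \<in> ball e d1"
    using h by (auto simp: dist_real_def abs_minus_commute)
  have \<gamma>t: "\<gamma> t \<in> ?N \<epsilon>"
    using d1(2) t' by blast
  have close: "norm (coords c (\<gamma> t) - coords c (\<gamma> e) - (t - e) *\<^sub>R V e c) \<le> \<epsilon> / 2 * h"
    using d2(2)[OF t'(1)] t h by simp
  \<comment> \<open>The first bound keeps \<open>q\<close> in the ball where segments are available;
    the second is the remaining half of the error \<open>h * \<epsilon>\<close>.\<close>
  define \<eta> where "\<eta> = min \<epsilon> (\<epsilon> / 2 * h)"
  have "\<eta> > 0"
    using \<epsilon>(1) h by (simp add: \<eta>_def)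
  have rel: "if e = b then arc_related M (\<gamma> t) q else arc_related M q (\<gamma> t)" if q: "q \<in> ?N \<eta>" for q
  proof -
    have q\<epsilon>: "q \<in> chart_dom c" "coords c q \<in> ball (coords c (\<gamma> e)) \<epsilon>"
      and q_close: "norm (coords c q - coords c (\<gamma> e)) < \<epsilon> / 2 * h"
      using q by (auto simp: \<eta>_def dist_norm norm_minus_commute)
    have bound: "norm (coords c (\<gamma> t) - coords c q - (t - e) *\<^sub>R V e c) < h * \<epsilon>"
    proof -
      have "norm (coords c (\<gamma> t) - coords c q - (t - e) *\<^sub>R V e c) =
          norm ((coords c (\<gamma> t) - coords c (\<gamma> e) - (t - e) *\<^sub>R V e c) - (coords c q - coords c (\<gamma> e)))"
        by (simp add: algebra_simps)
      also have "\<dots> \<le> norm (coords c (\<gamma> t) - coords c (\<gamma> e) - (t - e) *\<^sub>R V e c) + norm (coords c q - coords c (\<gamma> e))"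
        by (rule norm_triangle_ineq4)
      also have "\<dots> < h * \<epsilon>"
        using close q_close by (simp add: field_simps)
      finally show ?thesis .
    qed
    show ?thesis
    proof (cases "e = b")
      case True
      then have te: "t - e = - h"
        by (simp add: t_def)
      \<comment> \<open>At the right end the segment runs from \<open>\<gamma> t\<close> to
        \<open>q\<close>, so the difference estimated above enters with opposite sign.\<close>
      have "coords c q - coords c (\<gamma> t) - h *\<^sub>R V e c = - (coords c (\<gamma> t) - coords c q - (t - e) *\<^sub>R V e c)"
        unfolding te by (simp add: algebra_simps)
      then have "norm (coords c q - coords c (\<gamma> t) - h *\<^sub>R V e c) < h * \<epsilon>"
        using bound by (simp only: norm_minus_cancel)
      then show ?thesis
        using segment[of "\<gamma> t" q h] \<gamma>t q\<epsilon> h(1) True by simp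
    next
      case False
      then have "t - e = h"
        using e by (simp add: t_def)
      then show ?thesis
        using segment[of q "\<gamma> t" h] \<gamma>t q\<epsilon> h(1) bound False by simp
    qed
  qed
  show thesis
  proof (rule that)
    show "openin (points M) (?N \<eta>)"
      by (rule open_coords_vimage[OF c(1) open_ball])
    show "\<gamma> e \<in> ?N \<eta>"
      using c(2) \<open>\<eta> > 0\<close> by simp
  qed (use t rel in blast)+
qed

lemma openin_chronological_from: "openin (points M) {y. chronological M x y}"
proof (subst openin_subopen, intro ballI)
  fix y assume "y \<in> {y. chronological M x y}"
  then have "(arc_related M)\<^sup>+\<^sup>+ x y"
    by (simp add: chronological_eq_tranclp)
  then obtain z where xz: "(arc_related M)\<^sup>*\<^sup>* x z" and "arc_related M z y"
    by (metis tranclpD tranclp.cases rtranclp.rtrancl_refl tranclp_into_rtranclp)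
  then obtain a b \<gamma> V where arc: "timelike_arc M a b \<gamma> V" and zy: "\<gamma> a = z" "\<gamma> b = y"
    unfolding arc_related_def by blast
  obtain U t where U: "openin (points M) U" "\<gamma> b \<in> U" and t: "a < t" "t < b"
    and rel: "\<And>q. q \<in> U \<Longrightarrow> arc_related M (\<gamma> t) q"
    by (rule timelike_arc_endpoint[OF arc insertI2[OF singletonI]]) (rule that; simp)
  \<comment> \<open>Only the last arc of the chain changes: it is cut at \<open>\<gamma> t\<close>,
    from where every point of \<open>U\<close> is reached.\<close>
  have "timelike_arc M a t \<gamma> V"
    using t by (auto intro!: timelike_arc_subinterval[OF arc])
  then have "arc_related M z (\<gamma> t)"
    using zy unfolding arc_related_def by blast
  with xz have "(arc_related M)\<^sup>+\<^sup>+ x (\<gamma> t)"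
    by (rule rtranclp_into_tranclp1)
  then have "U \<subseteq> {y. chronological M x y}"
    using rel by (auto simp: chronological_eq_tranclp intro: tranclp.trancl_into_trancl)
  then show "\<exists>T. openin (points M) T \<and> y \<in> T \<and> T \<subseteq> {y. chronological M x y}"
    using U zy by blast
qed

lemma openin_chronological_to: "openin (points M) {x. chronological M x y}"
proof (subst openin_subopen, intro ballI)
  fix x assume "x \<in> {x. chronological M x y}"
  then have "(arc_related M)\<^sup>+\<^sup>+ x y"
    by (simp add: chronological_eq_tranclp)
  then obtain z where "arc_related M x z" and zy: "(arc_related M)\<^sup>*\<^sup>* z y"
    by (metis tranclpD)
  then obtain a b \<gamma> V where arc: "timelike_arc M a b \<gamma> V" and xz: "\<gamma> a = x" "\<gamma> b = z"
    unfolding arc_related_def by blast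
  have "a \<noteq> b"
    using timelike_arcD(1)[OF arc] by simp
  obtain U t where U: "openin (points M) U" "\<gamma> a \<in> U" and t: "a < t" "t < b"
    and rel: "\<And>q. q \<in> U \<Longrightarrow> arc_related M q (\<gamma> t)"
    by (rule timelike_arc_endpoint[OF arc insertI1]) (rule that; simp add: \<open>a \<noteq> b\<close>)
  have "timelike_arc M t b \<gamma> V"
    using t by (auto intro!: timelike_arc_subinterval[OF arc])
  then have "arc_related M (\<gamma> t) z"
    using xz unfolding arc_related_def by blast
  then have "(arc_related M)\<^sup>+\<^sup>+ (\<gamma> t) y"
    using zy by (rule rtranclp_into_tranclp2)
  then have "U \<subseteq> {x. chronological M x y}"
    using rel by (auto simp: chronological_eq_tranclp intro: tranclp_into_tranclp2)
  then show "\<exists>T. openin (points M) T \<and> x \<in> T \<and> T \<subseteq> {x. chronological M x y}"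
    using U xz by blast
qed

lemma chronological_nearby:
  assumes U: "openin (points M) U" "p \<in> U"
  shows "\<exists>q\<in>U. chronological M p q" "\<exists>q\<in>U. chronological M q p"
proof -
  have p: "p \<in> topspace (points M)"
    using U openin_subset by blast
  obtain v where v: "future_timelike M p v"
    using orientation_tangent[OF p] by blast
  obtain c where c: "c \<in> atlas M" "p \<in> chart_dom c"
    using p by (rule charts_cover)
  obtain \<epsilon> where \<epsilon>: "\<epsilon> > 0" "ball (coords c p) \<epsilon> \<subseteq> chart_image c"
    and segment: "\<And>q r s. q \<in> chart_dom c \<Longrightarrow> r \<in> chart_dom c \<Longrightarrow>
      coords c q \<in> ball (coords c p) \<epsilon> \<Longrightarrow> coords c r \<in> ball (coords c p) \<epsilon> \<Longrightarrow> 0 < s \<Longrightarrow>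
      norm (coords c r - coords c q - s *\<^sub>R v c) < s * \<epsilon> \<Longrightarrow> arc_related M q r"
    by (rule segments_near_timelike[OF c v]) (rule that; blast)
  have "coords c p \<in> coords c ` (chart_dom c \<inter> U)"
    using c(2) U(2) by blast
  then obtain \<delta> where \<delta>: "\<delta> > 0" "ball (coords c p) \<delta> \<subseteq> coords c ` (chart_dom c \<inter> U)"
    using open_coords_image[OF c(1) U(1)] open_contains_ball by blast
  \<comment> \<open>The \<open>+ 1\<close> keeps the denominator positive and makes the displacement
    \<open>s * norm (v c)\<close> strictly smaller than both radii.\<close>
  define s where "s = min \<epsilon> \<delta> / (norm (v c) + 1)"
  have "norm (v c) + 1 > 0"
    using norm_ge_zero[of "v c"] by linarith
  then have s: "s > 0"
    using \<epsilon>(1) \<delta>(1) by (simp add: s_def)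
  have "s * (norm (v c) + 1) = min \<epsilon> \<delta>"
    using \<open>norm (v c) + 1 > 0\<close> by (simp add: s_def)
  then have "s * norm (v c) + s = min \<epsilon> \<delta>"
    by (simp only: distrib_left mult_1_right)
  then have small: "s * norm (v c) < min \<epsilon> \<delta>"
    using s by linarith
  have point: "\<exists>q \<in> chart_dom c \<inter> U. coords c q = coords c p + r *\<^sub>R v c \<and> coords c q \<in> ball (coords c p) \<epsilon>"
    if "\<bar>r\<bar> = s" for r
  proof -
    have "coords c p + r *\<^sub>R v c \<in> ball (coords c p) \<epsilon>" "coords c p + r *\<^sub>R v c \<in> ball (coords c p) \<delta>"
      using small that by (simp_all add: dist_norm)
    then show ?thesis
      using \<delta>(2) by fastforce
  qed
  have p\<epsilon>: "coords c p \<in> ball (coords c p) \<epsilon>"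
    using \<epsilon>(1) by simp
  obtain q where q: "q \<in> chart_dom c" "q \<in> U" "coords c q = coords c p + s *\<^sub>R v c" "coords c q \<in> ball (coords c p) \<epsilon>"
    using point[of s] s by (auto simp del: mem_ball)
  \<comment> \<open>The displacement is exactly \<open>s\<close> times \<open>v c\<close>, so the
    error in the norm condition is 0.\<close>
  have "arc_related M p q"
    by (rule segment[OF c(2) q(1) p\<epsilon> q(4) s]) (use q(3) s \<epsilon>(1) in simp)
  then show "\<exists>q\<in>U. chronological M p q"
    using q(2) by (intro bexI[of _ q] arc_related_imp_chronological)
  obtain r where r: "r \<in> chart_dom c" "r \<in> U" "coords c r = coords c p + (- s) *\<^sub>R v c" "coords c r \<in> ball (coords c p) \<epsilon>"
    using point[of "- s"] s by (auto simp del: mem_ball)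
  have "arc_related M r p"
    by (rule segment[OF r(1) c(2) r(4) p\<epsilon> s]) (use r(3) s \<epsilon>(1) in simp)
  then show "\<exists>q\<in>U. chronological M q p"
    using r(2) by (intro bexI[of _ r] arc_related_imp_chronological)
qed

lemma chronology_chronological: "chronology (points M) (chronological M)"
proof
  show "x \<in> topspace (points M) \<and> y \<in> topspace (points M)" if "chronological M x y" for x y
    using that unfolding chronological_eq_tranclp
    by induction (auto dest: arc_related_in_points)
  show "chronological M x z" if "chronological M x y" "chronological M y z" for x y z
    using that unfolding chronological_eq_tranclp by (rule tranclp_trans)
  show "\<exists>y. chronological M x y \<and> chronological M y z" if xz: "chronological M x z" for x z
  proof -
    \<comment> \<open>Interpolation splits only the first arc of the chain.\<close>
    obtain w where "arc_related M x w" "(arc_related M)\<^sup>*\<^sup>* w z"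
      using xz unfolding chronological_eq_tranclp by (metis tranclpD)
    moreover obtain y where "arc_related M x y" "arc_related M y w"
      using arc_related_interpolate[OF \<open>arc_related M x w\<close>] .
    ultimately show ?thesis
      unfolding chronological_eq_tranclp by (meson rtranclp_into_tranclp2 tranclp.r_into_trancl)
  qed
qed (fact openin_chronological_from openin_chronological_to chronological_nearby)+

end

theorem corollary7p46:
  fixes M :: "('a, 'e::euclidean_space) spacetime"
  assumes "smooth_spacetime M"
  shows "(\<exists>f. bij_betw f (prime_elements (locale_of_futures M)) (indecomposable_pasts M)) \<and>
         (\<exists>f. bij_betw f (prime_elements (locale_of_pasts M)) (indecomposable_futures M))"
proof -
  interpret chronological_spacetime M
    by unfold_locales (rule assms)
  interpret future: chronology "points M" "chronological M"
    by (rule chronology_chronological)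
  \<comment> \<open>Down-sets of the reversed relation are future sets, because the double converse
    cancels; the bijection for pasts is thus another instance of the same theorem.\<close>
  interpret past: chronology "points M" "(chronological M)\<inverse>\<inverse>"
    by (rule future.dual)
  have cones: "chron_future M = up_set (chronological M)" "chron_past M = up_set (chronological M)\<inverse>\<inverse>"
    by (auto simp: fun_eq_iff chron_future_def chron_past_def up_set_def)
  have "indecomposable_pasts M = future.indecomposable_down_sets"
    "indecomposable_futures M = past.indecomposable_down_sets"
    unfolding indecomposable_pasts_def indecomposable_futures_def cones
      future.indecomposable_down_sets_def past.indecomposable_down_sets_def conversep_conversep
    by (rule refl)+
  then show ?thesis
    using future.prime_bij_indecomposable past.prime_bij_indecomposable
    unfolding locale_of_futures_def locale_of_pasts_def cones by auto
qed

end
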